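(* For every $n\ge1$ the permutohedra satisfy $$\gamma(Pe^n)=\gamma(Pe^{n-1})+\tau\sum_{i=1}^{n-1}\binom{n}{i}\gamma(Pe^{i-1})\,\gamma(Pe^{n-i-1}),$$ $$H(Pe^n)=(\alpha+t)H(Pe^{n-1})+\alpha t\sum_{i=1}^{n-1}\binom{n}{i}H(Pe^{i-1})\,H(Pe^{n-i-1}).$$
   Context: Notation: $[m]=\{1,\ldots,m\}$. For a simple graph $\Gamma$ on $[n+1]$, $B(\Gamma)$ is the collection of nonempty $S\subseteq[n+1]$ such that the induced subgraph $\Gamma|_S$ is connected. The graph-associahedron is the Minkowski sum $P_\Gamma=\sum_{S\in B(\Gamma)}\mathrm{conv}\{e_i : i\in S\}\subset\mathbb{R}^{n+1}$, with $e_i$ the standard basis vectors; for connected $\Gamma$ it is a simple polytope of dimension $n$. The permutohedron is $Pe^n=P_{K_{n+1}}$, where $K_{n+1}$ is the complete graph on $[n+1]$ ($Pe^0$ is a point). For a $d$-dimensional simple polytope $P$, let $f_i$ be the number of its $i$-dimensional faces ($f_d=1$), $F(P)(\alpha,t)=\sum_{i=0}^d f_i\alpha^i t^{d-i}$ and $H(P)(\alpha,t)=F(P)(\alpha-t,t)$. By the Dehn–Sommerville equations $H(P)$ is symmetric, so it is uniquely written as $H(P)=\sum_{i=0}^{\lfloor d/2\rfloor}\gamma_i(\alpha t)^i(\alpha+t)^{d-2i}$; the $\gamma$-polynomial is $\gamma(P)(\tau)=\sum_{i=0}^{\lfloor d/2\rfloor}\gamma_i\tau^i$. For a point, $H=\gamma=1$.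 Empty sums are $0$. *)

theory Defs
  imports
    "HOL-Analysis.Analysis"
    "HOL-Analysis.Finite_Function_Topology"
    "HOL-Library.Set_Algebras"
    "HOL-Computational_Algebra.Polynomial"
begin

text \<open>
  A simple graph on \<open>{1..m}\<close> is given by its symmetric irreflexive edge relation.
\<close>

definition connected_on :: "nat rel \<Rightarrow> nat set \<Rightarrow> bool" where
  "connected_on E S \<longleftrightarrow> (\<forall>i\<in>S. \<forall>j\<in>S. (i, j) \<in> (E \<inter> S \<times> S)\<^sup>*)"

definition building_set :: "nat \<Rightarrow> nat rel \<Rightarrow> nat set set" where
  "building_set m E = {S. S \<noteq> {} \<and> S \<subseteq> {1..m} \<and> connected_on E S}"

text \<open>
  Polytopes of all dimensions live in the one real vector space \<^typ>\<open>nat \<Rightarrow>\<^sub>0 real\<close> of finitely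
  supported sequences; \<open>\<real>\<^sup>m\<close> is its subspace of sequences supported in \<open>{1..m}\<close>, with standard
  basis vectors \<open>Poly_Mapping.single i 1\<close>. The sum of sets below is the Minkowski sum.
\<close>

definition graph_associahedron :: "nat \<Rightarrow> nat rel \<Rightarrow> (nat \<Rightarrow>\<^sub>0 real) set" where
  "graph_associahedron m E =
     (\<Sum>S\<in>building_set m E. convex hull ((\<lambda>i. Poly_Mapping.single i 1) ` S))"

definition complete_graph :: "nat \<Rightarrow> nat rel" where
  "complete_graph m = {(i, j). i \<in> {1..m} \<and> j \<in> {1..m} \<and> i \<noteq> j}"

definition permutohedron :: "nat \<Rightarrow> (nat \<Rightarrow>\<^sub>0 real) set" where
  "permutohedron n = graph_associahedron (n + 1) (complete_graph (n + 1))"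

text \<open>
  Dimension of the affine hull of a nonempty set, i.e. of the linear space parallel to it.
  (The library's \<^const>\<open>aff_dim\<close> is restricted to the class \<^class>\<open>euclidean_space\<close>, to which
  \<^typ>\<open>nat \<Rightarrow>\<^sub>0 real\<close> does not belong.)
\<close>

definition affine_dim :: "'a::real_vector set \<Rightarrow> nat" where
  "affine_dim S = dim {x - y | x y. x \<in> S \<and> y \<in> S}"

definition face_number :: "'a::real_vector set \<Rightarrow> nat \<Rightarrow> nat" where
  "face_number P i = card {F. F face_of P \<and> F \<noteq> {} \<and> affine_dim F = i}"

text \<open>
  Polynomials in \<open>\<alpha>\<close> and \<open>t\<close> are elements of \<open>\<int>[t][\<alpha>]\<close>: the outer variable is \<open>\<alpha>\<close>, the inner one \<open>t\<close>.
\<close>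

definition var_alpha :: "int poly poly" where
  "var_alpha = [:0, 1:]"

definition var_t :: "int poly poly" where
  "var_t = [:[:0, 1:]:]"

definition var_tau :: "int poly" where
  "var_tau = [:0, 1:]"

definition F_poly :: "'a::real_vector set \<Rightarrow> int poly poly" where
  "F_poly P = (\<Sum>i\<le>affine_dim P.
     of_nat (face_number P i) * var_alpha ^ i * var_t ^ (affine_dim P - i))"

text \<open>Substitution of \<open>\<alpha> - t\<close> for \<open>\<alpha>\<close>, leaving \<open>t\<close> fixed.\<close>

definition H_poly :: "'a::real_vector set \<Rightarrow> int poly poly" where
  "H_poly P = pcompose (F_poly P) (var_alpha - var_t)"

definition gamma_poly :: "'a::real_vector set \<Rightarrow> int poly" where
  "gamma_poly P = (THE g. degree g \<le> affine_dim P div 2 \<and>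
     H_poly P = (\<Sum>i\<le>affine_dim P div 2. of_int (coeff g i) *
       (var_alpha * var_t) ^ i * (var_alpha + var_t) ^ (affine_dim P - 2 * i)))"

end

theory Submission
  imports Defs
begin

text \<open>
  The permutohedron \<open>Pe\<^sup>n\<close> is the Minkowski sum of the simplices over all nonempty subsets of
  \<open>M = {1..n+1}\<close>. Its combinatorial type is read off from its description by inequalities: it
  consists of the vectors supported in \<open>M\<close> whose coordinate sum over every \<open>S \<subseteq> M\<close> is at least
  \<open>2\<^sup>|\<^sup>S\<^sup>| - 1\<close>, with equality for \<open>S = M\<close>. The bound is strictly supermodular, so the sets on
  which a point attains it form a chain (\<open>tight_sets_chain\<close>). A chain from the empty set to \<open>M\<close>
  is the same as an ordered partition of \<open>M\<close>, that is, a surjection of \<open>M\<close> onto some \<open>{..<k}\<close>;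
  each of these occurs, and the nonempty faces correspond to them bijectively, the one for a surjection
  onto \<open>{..<k}\<close> having dimension \<open>|M| - k\<close> (\<open>face_of_base_polytope_imp_rank_face\<close>,
  \<open>affine_dim_rank_face\<close>, \<open>face_number_simplex_sum\<close>).

  Hence \<open>t F(Pe\<^sup>n)(x, t)\<close> is the homogeneous polynomial \<open>surj_poly (n+1) x t\<close>, the sum of
  \<open>a(n+1,k) x\<^sup>n\<^sup>+\<^sup>1\<^sup>-\<^sup>k t\<^sup>k\<close> with \<open>a(m,k)\<close> the number of surjections from \<open>m\<close> points onto \<open>k\<close> points.
  At \<open>x = 1\<close> the exponential generating function is \<open>G(z) = 1/(1 - t(e\<^sup>z - 1))\<close>, which satisfies
  \<open>G' = (1 + t) G\<^sup>2 - G\<close>. The homogeneous, coefficientwise form of this differential equation is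
  \<open>surj_poly_Suc\<close>; taking the two extreme terms out of the square and substituting
  \<open>x = \<alpha> - t\<close> gives the recurrence for \<open>H\<close>.

  Expanding a polynomial in \<open>\<tau>\<close> as \<open>\<Sum>\<^sub>i \<gamma>\<^sub>i (\<alpha>t)\<^sup>i (\<alpha>+t)\<^sup>d\<^sup>-\<^sup>2\<^sup>i\<close> is linear, injective and
  multiplicative with \<open>d\<close> additive (\<open>gamma_expand_mult\<close>, \<open>gamma_expand_eq_0\<close>). It sends \<open>1\<close> to
  \<open>\<alpha> + t\<close> for \<open>d = 1\<close> and \<open>\<tau>\<close> to \<open>\<alpha>t\<close> for \<open>d = 2\<close>, so it carries the recurrence for \<open>\<gamma>\<close> to the
  one for \<open>H\<close>. Solving the former recursively therefore shows at once, by induction, that the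
  \<open>\<gamma>\<close>-polynomials exist and that they obey it.
\<close>

section \<open>Coordinate sums and simplices\<close>

lemma lookup_scaleR [simp]:
  "Poly_Mapping.lookup (c *\<^sub>R x) i = c *\<^sub>R Poly_Mapping.lookup x i"
proof -
  have "finite {i. c *\<^sub>R Poly_Mapping.lookup x i \<noteq> 0}"
    by (rule finite_subset[OF _ finite_keys[of x]]) (auto simp: in_keys_iff)
  then show ?thesis
    by (simp add: scaleR_poly_mapping_def)
qed

abbreviation unit_vec :: "'a \<Rightarrow> 'a \<Rightarrow>\<^sub>0 real" where
  "unit_vec i \<equiv> Poly_Mapping.single i 1"

definition coord_sum :: "('a \<Rightarrow>\<^sub>0 real) \<Rightarrow> 'a set \<Rightarrow> real" where
  "coord_sum x S = (\<Sum>i\<in>S. Poly_Mapping.lookup x i)"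

lemma coord_sum_empty [simp]: "coord_sum x {} = 0"
  by (simp add: coord_sum_def)

lemma coord_sum_add [simp]: "coord_sum (x + y) S = coord_sum x S + coord_sum y S"
  by (simp add: coord_sum_def lookup_add sum.distrib)

lemma coord_sum_diff [simp]: "coord_sum (x - y) S = coord_sum x S - coord_sum y S"
  by (simp add: coord_sum_def lookup_minus sum_subtractf)

lemma coord_sum_scaleR [simp]: "coord_sum (c *\<^sub>R x) S = c * coord_sum x S"
  by (simp add: coord_sum_def sum_distrib_left)

lemma coord_sum_sum: "coord_sum (sum f A) S = (\<Sum>a\<in>A. coord_sum (f a) S)"
  unfolding coord_sum_def lookup_sum by (rule sum.swap)

lemma coord_sum_single:
  "finite S \<Longrightarrow> coord_sum (Poly_Mapping.single i c) S = (if i \<in> S then c else 0)"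
  by (auto simp: coord_sum_def lookup_single when_def)

lemma coord_sum_Un_Int:
  "finite S \<Longrightarrow> finite T \<Longrightarrow>
    coord_sum x (S \<union> T) + coord_sum x (S \<inter> T) = coord_sum x S + coord_sum x T"
  unfolding coord_sum_def by (rule sum.union_inter)

lemma keys_add_scaleR_subset:
  assumes "Poly_Mapping.keys x \<subseteq> M" "Poly_Mapping.keys y \<subseteq> M"
  shows "Poly_Mapping.keys (x + c *\<^sub>R y) \<subseteq> M"
proof
  fix i assume "i \<in> Poly_Mapping.keys (x + c *\<^sub>R y)"
  then have "Poly_Mapping.lookup x i \<noteq> 0 \<or> Poly_Mapping.lookup y i \<noteq> 0"
    by (auto simp: in_keys_iff lookup_add)
  with assms show "i \<in> M" by (auto simp flip: in_keys_iff)
qed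

lemma simplex_coords:
  fixes x :: "'a \<Rightarrow>\<^sub>0 real"
  assumes "finite U" "x \<in> convex hull (unit_vec ` U)"
  shows "0 \<le> Poly_Mapping.lookup x i" "Poly_Mapping.keys x \<subseteq> U" "coord_sum x U = 1"
proof -
  let ?C = "{x. (\<forall>i. 0 \<le> Poly_Mapping.lookup x i) \<and> Poly_Mapping.keys x \<subseteq> U \<and> coord_sum x U = 1}"
  have "convex ?C"
  proof (rule convexI)
    fix x y :: "'a \<Rightarrow>\<^sub>0 real" and u v :: real
    assume H: "x \<in> ?C" "y \<in> ?C" "0 \<le> u" "0 \<le> v" "u + v = 1"
    have "Poly_Mapping.keys (u *\<^sub>R x + v *\<^sub>R y) \<subseteq> U"
      using H by (intro keys_add_scaleR_subset) (auto simp: in_keys_iff)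
    with H show "u *\<^sub>R x + v *\<^sub>R y \<in> ?C" by (simp add: lookup_add)
  qed
  moreover have "unit_vec ` U \<subseteq> ?C"
    using assms(1) by (auto simp: lookup_single when_def coord_sum_single)
  ultimately have "convex hull (unit_vec ` U) \<subseteq> ?C"
    by (metis (no_types, lifting) hull_minimal)
  with assms(2) have "x \<in> ?C" by blast
  then show "0 \<le> Poly_Mapping.lookup x i" "Poly_Mapping.keys x \<subseteq> U" "coord_sum x U = 1" by auto
qed

text \<open>
  The barycentre of the simplex with vertex set \<open>S\<close>.
\<close>

definition uniform_vec :: "'a set \<Rightarrow> 'a \<Rightarrow>\<^sub>0 real" where
  "uniform_vec S = (\<Sum>i\<in>S. Poly_Mapping.single i (1 / card S))"

lemma uniform_vec_in_simplex:
  assumes "finite S" "S \<noteq> {}" "S \<subseteq> U"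
  shows "uniform_vec S \<in> convex hull (unit_vec ` U)"
proof -
  have "(\<Sum>i\<in>S. (1 / card S) *\<^sub>R unit_vec i) \<in> convex hull (unit_vec ` U)"
    using assms by (intro convex_sum) (auto intro: hull_inc convex_convex_hull)
  moreover have "(1 / card S) *\<^sub>R unit_vec i = Poly_Mapping.single i (1 / card S)" for i :: 'a
    by (rule poly_mapping_eqI) (simp add: lookup_single when_def)
  ultimately show ?thesis by (simp add: uniform_vec_def)
qed

lemma lookup_uniform_vec:
  "finite S \<Longrightarrow> Poly_Mapping.lookup (uniform_vec S) i = (if i \<in> S then 1 / card S else 0)"
  by (simp add: uniform_vec_def lookup_sum lookup_single when_def)

text \<open>
  The number of nonempty subsets of a finite set \<open>S\<close>, as a real number.
\<close>

definition subset_count :: "'a set \<Rightarrow> real" where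
  "subset_count S = 2 ^ card S - 1"

lemma subset_count_empty [simp]: "subset_count {} = 0"
  by (simp add: subset_count_def)

lemma subset_count_eq_sum:
  assumes "finite M" "S \<subseteq> M"
  shows "subset_count S = (\<Sum>U\<in>Pow M - {{}}. if U \<subseteq> S then 1 else 0)"
proof -
  have fS: "finite S" using assms finite_subset by blast
  have "(\<Sum>U\<in>Pow M - {{}}. if U \<subseteq> S then 1 else 0) = real (card ((Pow M - {{}}) \<inter> {U. U \<subseteq> S}))"
    using assms by (simp add: sum.If_cases)
  also have "(Pow M - {{}}) \<inter> {U. U \<subseteq> S} = Pow S - {{}}" using assms by auto
  also have "real (card (Pow S - {{}})) = subset_count S"
    using fS by (simp add: card_Diff_singleton card_Pow subset_count_def of_nat_diff)
  finally show ?thesis by simp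
qed

text \<open>
  Strictness is what forces the tight sets of a point into a chain: the sets contained in
  \<open>S \<union> T\<close> but in neither \<open>S\<close> nor \<open>T\<close> are counted on the right only.
\<close>

lemma subset_count_supermodular:
  assumes "finite S" "finite T" "\<not> S \<subseteq> T" "\<not> T \<subseteq> S"
  shows "subset_count S + subset_count T < subset_count (S \<union> T) + subset_count (S \<inter> T)"
proof -
  let ?a = "card (S \<inter> T)" and ?p = "card (S - T)" and ?q = "card (T - S)"
  have cS: "card S = ?a + ?p" 
    using assms card_Int_Diff by blast
  have cT: "card T = ?a + ?q"
    using assms card_Int_Diff by (metis Int_commute)
  have cU: "card (S \<union> T) = ?a + ?p + ?q"
    using card_Un_Int[of S T] cS cT assms by simp
  have pq: "?p > 0" "?q > 0" using assms by (auto simp: card_gt_0_iff)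
  have "(1::real) < 2 ^ ?p" "(1::real) < 2 ^ ?q" using pq by (auto intro: one_less_power)
  then have "0 < (2::real) ^ ?a * ((2 ^ ?p - 1) * (2 ^ ?q - 1))" by simp
  then show ?thesis
    unfolding subset_count_def cS cT cU by (simp add: power_add algebra_simps)
qed

definition simplex_sum :: "'a set \<Rightarrow> ('a \<Rightarrow>\<^sub>0 real) set" where
  "simplex_sum M = (\<Sum>U\<in>Pow M - {{}}. convex hull (unit_vec ` U))"

lemma convex_simplex_sum: "convex (simplex_sum M)"
  unfolding simplex_sum_def by (rule convex_set_sum) (rule convex_convex_hull)

section \<open>The sum of simplices as a base polytope\<close>

definition base_polytope :: "'a set \<Rightarrow> ('a \<Rightarrow>\<^sub>0 real) set" where
  "base_polytope M = {x. Poly_Mapping.keys x \<subseteq> M \<and> coord_sum x M = subset_count M \<and>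
     (\<forall>S\<subseteq>M. subset_count S \<le> coord_sum x S)}"

text \<open>
  For a point of the base polytope this family determines the smallest face containing it.
\<close>

definition tight_sets :: "'a set \<Rightarrow> ('a \<Rightarrow>\<^sub>0 real) \<Rightarrow> 'a set set" where
  "tight_sets M x = {S. S \<subseteq> M \<and> coord_sum x S = subset_count S}"

text \<open>
  The chain encoded by a rank function \<open>r\<close>. Only the weak order that \<open>r\<close> induces on \<open>M\<close> matters.
\<close>

definition downsets :: "'a set \<Rightarrow> ('a \<Rightarrow> nat) \<Rightarrow> 'a set set" where
  "downsets M r = {S. S \<subseteq> M \<and> (\<forall>i\<in>S. \<forall>j\<in>M. r j \<le> r i \<longrightarrow> j \<in> S)}"

definition top_part :: "('a \<Rightarrow> nat) \<Rightarrow> 'a set \<Rightarrow> 'a set" where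
  "top_part r U = {i \<in> U. \<forall>j\<in>U. r j \<le> r i}"

text \<open>
  A relatively interior point of the face belonging to \<open>r\<close>: in each summand, the face selected
  by a linear functional increasing with \<open>r\<close> is the simplex on the elements of top rank, and its
  barycentre is taken.
\<close>

definition center :: "'a set \<Rightarrow> ('a \<Rightarrow> nat) \<Rightarrow> 'a \<Rightarrow>\<^sub>0 real" where
  "center M r = (\<Sum>U\<in>Pow M - {{}}. uniform_vec (top_part r U))"

lemma top_part_nonempty:
  assumes "finite U" "U \<noteq> {}"
  shows "top_part r U \<noteq> {}"
proof -
  from assms have "Max (r ` U) \<in> r ` U" by (intro Max_in) auto
  then obtain i where "i \<in> U" "r i = Max (r ` U)" by auto
  with assms have "i \<in> top_part r U" by (simp add: top_part_def)
  then show ?thesis by auto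
qed

lemma coord_sum_simplex_superset:
  fixes x :: "'a \<Rightarrow>\<^sub>0 real"
  assumes "finite S" "U \<subseteq> S" "x \<in> convex hull (unit_vec ` U)"
  shows "coord_sum x S = 1"
proof -
  have U: "finite U" using assms finite_subset by blast
  have "coord_sum x S = coord_sum x U"
    unfolding coord_sum_def using simplex_coords(2)[OF U assms(3)] assms
    by (intro sum.mono_neutral_right) (auto simp: in_keys_iff)
  then show ?thesis using simplex_coords(3)[OF U assms(3)] by simp
qed

text \<open>
  The contribution of one summand to the inequality for \<open>S\<close>. Summed over all \<open>U\<close>, the left-hand
  sides count the nonempty subsets of \<open>S\<close>.
\<close>

lemma coord_sum_simplex_ge:
  fixes x :: "'a \<Rightarrow>\<^sub>0 real"
  assumes "finite U" "finite S" "x \<in> convex hull (unit_vec ` U)"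
  shows "(if U \<subseteq> S then 1 else 0) \<le> coord_sum x S"
  using coord_sum_simplex_superset[OF assms(2) _ assms(3)] simplex_coords(1)[OF assms(1,3)]
  by (simp add: coord_sum_def sum_nonneg)

lemma center_in_simplex_sum:
  assumes "finite M"
  shows "center M r \<in> simplex_sum M"
proof -
  have "uniform_vec (top_part r U) \<in> convex hull (unit_vec ` U)" if "U \<in> Pow M - {{}}" for U
    using that assms finite_subset[of U M]
    by (intro uniform_vec_in_simplex top_part_nonempty) (auto simp: top_part_def)
  then show ?thesis
    using assms unfolding simplex_sum_def center_def by (subst set_sum_alt) auto
qed

lemma simplex_sum_subset_base_polytope:
  assumes "finite M"
  shows "simplex_sum M \<subseteq> base_polytope M"
proof
  fix x assume "x \<in> simplex_sum M"
  then obtain s where x: "x = sum s (Pow M - {{}})"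
    and s: "\<And>U. U \<in> Pow M - {{}} \<Longrightarrow> s U \<in> convex hull (unit_vec ` U)"
    using assms unfolding simplex_sum_def by (subst (asm) set_sum_alt) auto
  have fin: "finite U" if "U \<subseteq> M" for U using that assms finite_subset by blast
  have "Poly_Mapping.keys (s U) \<subseteq> M" if "U \<in> Pow M - {{}}" for U
    using simplex_coords(2)[OF fin s[OF that]] that by auto
  then have "Poly_Mapping.keys x \<subseteq> M"
    unfolding x by (intro order_trans[OF keys_sum]) auto
  moreover have "coord_sum x M = subset_count M"
    unfolding x coord_sum_sum subset_count_eq_sum[OF assms order_refl]
    using coord_sum_simplex_superset[OF assms _ s] by (intro sum.cong) auto
  moreover have "subset_count S \<le> coord_sum x S" if "S \<subseteq> M" for S
    unfolding x coord_sum_sum subset_count_eq_sum[OF assms that]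
    by (intro sum_mono coord_sum_simplex_ge fin s that) auto
  ultimately show "x \<in> base_polytope M" by (simp add: base_polytope_def)
qed

lemma center_in_base_polytope: "finite M \<Longrightarrow> center M r \<in> base_polytope M"
  using center_in_simplex_sum simplex_sum_subset_base_polytope by blast

text \<open>
  Tightness on \<open>S\<close> can be tested summand by summand. A down-closed \<open>S\<close> misses the top part of
  each \<open>U\<close> not contained in it; conversely, if \<open>i \<in> S\<close> and \<open>j \<notin> S\<close> with \<open>r j \<le> r i\<close>, the
  summand \<open>U = {i, j}\<close> contributes a positive excess.
\<close>

lemma tight_sets_center:
  assumes "finite M"
  shows "tight_sets M (center M r) = downsets M r"
proof -
  have fin: "finite U" if "U \<subseteq> M" for U using that assms finite_subset by blast
  let ?u = "\<lambda>U. uniform_vec (top_part r U)"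
  have lookup_u: "Poly_Mapping.lookup (?u U) i = (if i \<in> top_part r U then 1 / card (top_part r U) else 0)"
    if "U \<subseteq> M" for U i
    using fin[OF that] by (intro lookup_uniform_vec) (auto simp: top_part_def)
  have u_simplex: "?u U \<in> convex hull (unit_vec ` U)" if "U \<in> Pow M - {{}}" for U
    using that fin[of U]
    by (intro uniform_vec_in_simplex top_part_nonempty) (auto simp: top_part_def)
  have tight_iff: "coord_sum (center M r) S = subset_count S \<longleftrightarrow>
      (\<forall>U\<in>Pow M - {{}}. coord_sum (?u U) S = (if U \<subseteq> S then 1 else 0))" if "S \<subseteq> M" for S
  proof -
    have "coord_sum (center M r) S = subset_count S \<longleftrightarrow>
        (\<Sum>U\<in>Pow M - {{}}. coord_sum (?u U) S - (if U \<subseteq> S then 1 else 0)) = 0"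
      by (simp add: center_def coord_sum_sum subset_count_eq_sum[OF assms that] sum_subtractf)
    also have "\<dots> \<longleftrightarrow> (\<forall>U\<in>Pow M - {{}}. coord_sum (?u U) S - (if U \<subseteq> S then 1 else 0) = 0)"
      using assms coord_sum_simplex_ge[OF fin fin[OF that] u_simplex]
      by (intro sum_nonneg_eq_0_iff) auto
    finally show ?thesis by simp
  qed
  show ?thesis
  proof (intro equalityI subsetI)
    fix S assume S: "S \<in> tight_sets M (center M r)"
    then have SM: "S \<subseteq> M" by (simp add: tight_sets_def)
    have "j \<in> S" if "i \<in> S" "j \<in> M" "r j \<le> r i" for i j
    proof (rule ccontr)
      assume j: "j \<notin> S"
      have U: "{i, j} \<in> Pow M - {{}}" using that SM by auto
      have i: "i \<in> top_part r {i, j}" using that by (auto simp: top_part_def)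
      have f: "finite (top_part r {i, j})" by (simp add: top_part_def)
      have "0 < Poly_Mapping.lookup (?u {i, j}) i"
        using U lookup_u[of "{i, j}" i] i f by (auto simp: card_gt_0_iff)
      also have "\<dots> \<le> coord_sum (?u {i, j}) S"
        unfolding coord_sum_def using that(1) fin[OF SM] simplex_coords(1)[OF _ u_simplex[OF U]]
        by (intro member_le_sum) auto
      finally show False using tight_iff[OF SM] S U j by (auto simp: tight_sets_def)
    qed
    with SM show "S \<in> downsets M r" by (auto simp: downsets_def)
  next
    fix S assume S: "S \<in> downsets M r"
    then have SM: "S \<subseteq> M" by (simp add: downsets_def)
    have "coord_sum (?u U) S = (if U \<subseteq> S then 1 else 0)" if U: "U \<in> Pow M - {{}}" for U
    proof (cases "U \<subseteq> S")
      case True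
      then show ?thesis using coord_sum_simplex_superset[OF fin[OF SM] _ u_simplex[OF U]] by simp
    next
      case False
      then have "top_part r U \<inter> S = {}"
        using S U by (auto simp: top_part_def downsets_def)
      then have "coord_sum (?u U) S = 0"
        unfolding coord_sum_def using U by (intro sum.neutral) (auto simp: lookup_u)
      with False show ?thesis by simp
    qed
    with tight_iff[OF SM] SM show "S \<in> tight_sets M (center M r)"
      by (simp add: tight_sets_def)
  qed
qed

lemma tight_sets_chain:
  assumes "finite M" "x \<in> base_polytope M" "S \<in> tight_sets M x" "T \<in> tight_sets M x"
  shows "S \<subseteq> T \<or> T \<subseteq> S"
proof (rule ccontr)
  assume *: "\<not> (S \<subseteq> T \<or> T \<subseteq> S)"
  have sub: "S \<subseteq> M" "T \<subseteq> M" and eq: "coord_sum x S = subset_count S" "coord_sum x T = subset_count T"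
    using assms by (auto simp: tight_sets_def)
  have fin: "finite S" "finite T" using sub assms(1) finite_subset by blast+
  have "subset_count (S \<union> T) + subset_count (S \<inter> T) \<le> coord_sum x (S \<union> T) + coord_sum x (S \<inter> T)"
    using assms(2) sub unfolding base_polytope_def by (intro add_mono) (simp_all add: le_infI1)
  also have "\<dots> = subset_count S + subset_count T"
    using coord_sum_Un_Int[OF fin] eq by simp
  also have "\<dots> < subset_count (S \<union> T) + subset_count (S \<inter> T)"
    using subset_count_supermodular fin * by blast
  finally show False by simp
qed

text \<open>
  The rank of a point is the number of members of the chain that avoid it.
\<close>

lemma chain_eq_downsets:
  assumes M: "finite M" and T: "T \<subseteq> Pow M" "{} \<in> T" "M \<in> T"
    and chain: "\<And>S S'. S \<in> T \<Longrightarrow> S' \<in> T \<Longrightarrow> S \<subseteq> S' \<or> S' \<subseteq> S"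
  shows "\<exists>r. downsets M r = T"
proof -
  define r where "r i = card {S \<in> T. i \<notin> S}" for i
  have finT: "finite T" using T(1) M finite_subset by blast
  have le_iff: "r j \<le> r i \<longleftrightarrow> {S \<in> T. j \<notin> S} \<subseteq> {S \<in> T. i \<notin> S}" for i j
  proof
    assume "{S \<in> T. j \<notin> S} \<subseteq> {S \<in> T. i \<notin> S}"
    then show "r j \<le> r i" unfolding r_def using finT by (intro card_mono) auto
  next
    assume le: "r j \<le> r i"
    show "{S \<in> T. j \<notin> S} \<subseteq> {S \<in> T. i \<notin> S}"
    proof (rule ccontr)
      assume nsub: "\<not> {S \<in> T. j \<notin> S} \<subseteq> {S \<in> T. i \<notin> S}"
      then obtain S where S: "S \<in> T" "j \<notin> S" "i \<in> S" by auto
      have "{S \<in> T. i \<notin> S} \<subseteq> {S \<in> T. j \<notin> S}" using chain[OF S(1)] S by blast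
      with nsub have "{S \<in> T. i \<notin> S} \<subset> {S \<in> T. j \<notin> S}" by blast
      then have "r i < r j" unfolding r_def using finT by (intro psubset_card_mono) auto
      with le show False by simp
    qed
  qed
  have "downsets M r = T"
  proof (intro equalityI subsetI)
    fix S assume "S \<in> T"
    then show "S \<in> downsets M r" using T(1) by (auto simp: downsets_def le_iff)
  next
    fix D assume D: "D \<in> downsets M r"
    then have DM: "D \<subseteq> M" by (simp add: downsets_def)
    show "D \<in> T"
    proof (cases "D = {}")
      case False
      have finD: "finite D" using DM M finite_subset by blast
      with False have "Max (r ` D) \<in> r ` D" by (intro Max_in) auto
      then obtain i where i: "i \<in> D" "r i = Max (r ` D)" by auto
      have max: "r j \<le> r i" if "j \<in> D" for j using that finD i by simp
      let ?T = "{S \<in> T. i \<in> S}"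
      have "?T \<noteq> {}" using T(3) i DM by auto
      moreover have "finite ?T" using finT by simp
      ultimately obtain S where S: "S \<in> ?T" "\<And>S'. S' \<in> ?T \<Longrightarrow> S' \<subseteq> S \<Longrightarrow> S = S'"
        using finite_has_minimal[of ?T] by blast
      have S_least: "S \<subseteq> S'" if "S' \<in> ?T" for S'
        using chain[of S S'] S that by blast
      have "D \<subseteq> S" using max S(1) by (auto simp: le_iff)
      moreover have "S \<subseteq> D"
      proof
        fix j assume j: "j \<in> S"
        then have "j \<in> M" using S(1) T(1) by auto
        moreover have "r j \<le> r i" unfolding le_iff using S_least j by auto
        ultimately show "j \<in> D" using D i(1) by (auto simp: downsets_def)
      qed
      ultimately show ?thesis using S(1) by auto
    qed (simp add: T)
  qed
  then show ?thesis by blast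
qed

lemma tight_sets_eq_downsets:
  assumes "finite M" "x \<in> base_polytope M"
  shows "\<exists>r. tight_sets M x = downsets M r"
proof -
  have "{} \<in> tight_sets M x" "M \<in> tight_sets M x" "tight_sets M x \<subseteq> Pow M"
    using assms(2) by (auto simp: tight_sets_def base_polytope_def)
  then obtain r where "downsets M r = tight_sets M x"
    using chain_eq_downsets[of M "tight_sets M x"] tight_sets_chain assms by metis
  then show ?thesis by metis
qed

text \<open>
  Inequalities that are slack at \<open>x\<close> stay valid for a short while in any direction.
\<close>

lemma base_polytope_perturb:
  assumes M: "finite M" and x: "x \<in> base_polytope M" and d: "Poly_Mapping.keys d \<subseteq> M"
    and flat: "\<And>S. S \<in> tight_sets M x \<Longrightarrow> coord_sum d S = 0"
  shows "\<exists>\<epsilon>>0. x + \<epsilon> *\<^sub>R d \<in> base_polytope M"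
proof -
  have "\<forall>\<^sub>F e in at_right 0. subset_count S \<le> coord_sum (x + e *\<^sub>R d) S" if S: "S \<in> Pow M" for S
  proof (cases "S \<in> tight_sets M x")
    case True
    then show ?thesis using flat[OF True] by (simp add: tight_sets_def)
  next
    case False
    then have lt: "subset_count S < coord_sum x S"
      using x S by (auto simp: tight_sets_def base_polytope_def order_less_le)
    have "((\<lambda>e. coord_sum (x + e *\<^sub>R d) S) \<longlongrightarrow> coord_sum x S + 0 * coord_sum d S) (at_right 0)"
      by (simp only: coord_sum_add coord_sum_scaleR) (intro tendsto_intros)
    then have "\<forall>\<^sub>F e in at_right 0. subset_count S < coord_sum (x + e *\<^sub>R d) S"
      using lt by (intro order_tendstoD(1)) auto
    then show ?thesis by (rule eventually_mono) simp
  qed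
  then have "\<forall>\<^sub>F e in at_right 0. \<forall>S\<in>Pow M. subset_count S \<le> coord_sum (x + e *\<^sub>R d) S"
    using M by (intro eventually_ball_finite) auto
  moreover have "\<forall>\<^sub>F e in at_right (0::real). e > 0"
    by (rule eventually_at_right_less)
  ultimately have "\<forall>\<^sub>F e in at_right 0. e > 0 \<and> (\<forall>S\<in>Pow M. subset_count S \<le> coord_sum (x + e *\<^sub>R d) S)"
    by eventually_elim auto
  then obtain e :: real where e: "e > 0" "\<forall>S\<in>Pow M. subset_count S \<le> coord_sum (x + e *\<^sub>R d) S"
    using eventually_happens'[OF trivial_limit_at_right_real] by blast
  have "coord_sum d M = 0" using x flat by (auto simp: tight_sets_def base_polytope_def)
  then have "x + e *\<^sub>R d \<in> base_polytope M"
    using e x d keys_add_scaleR_subset[of x M d e] by (auto simp: base_polytope_def)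
  with e(1) show ?thesis by blast
qed

text \<open>
  If no tight set separates \<open>a\<close> from \<open>b\<close>, weight can be moved from \<open>b\<close> to \<open>a\<close> until a new
  inequality, necessarily for a set containing \<open>b\<close> but not \<open>a\<close>, becomes tight.
\<close>

lemma base_polytope_push:
  assumes M: "finite M" and x: "x \<in> base_polytope M" and ab: "a \<in> M" "b \<in> M" "a \<noteq> b"
    and same: "\<And>S. S \<in> tight_sets M x \<Longrightarrow> a \<in> S \<longleftrightarrow> b \<in> S"
  shows "\<exists>l>0. x + l *\<^sub>R (unit_vec a - unit_vec b) \<in> base_polytope M \<and>
    tight_sets M x \<subset> tight_sets M (x + l *\<^sub>R (unit_vec a - unit_vec b))"
proof -
  let ?d = "unit_vec a - unit_vec b :: 'a \<Rightarrow>\<^sub>0 real"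
  let ?F = "{S. S \<subseteq> M \<and> b \<in> S \<and> a \<notin> S}"
  let ?slack = "\<lambda>S. coord_sum x S - subset_count S"
  define l where "l = Min (?slack ` ?F)"
  have fin: "finite S" if "S \<subseteq> M" for S using that M finite_subset by blast
  have d: "coord_sum ?d S = (if a \<in> S then 1 else 0) - (if b \<in> S then 1 else 0)" if "S \<subseteq> M" for S
    using fin[OF that] by (simp add: coord_sum_single)
  have finF: "finite ?F" using M by simp
  have "{b} \<in> ?F" using ab by auto
  then have ne: "?slack ` ?F \<noteq> {}" by blast
  have "l \<in> ?slack ` ?F" unfolding l_def using finF ne by (intro Min_in) auto
  then obtain S0 where S0: "S0 \<in> ?F" "l = ?slack S0" by auto
  have l_le: "l \<le> ?slack S" if "S \<in> ?F" for S
    unfolding l_def using finF that by (intro Min_le) auto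
  have pos: "l > 0"
  proof -
    have "S0 \<notin> tight_sets M x" using same[of S0] S0 by auto
    moreover have "subset_count S0 \<le> coord_sum x S0"
      using x S0(1) by (simp add: base_polytope_def)
    ultimately show ?thesis using S0 by (simp add: tight_sets_def)
  qed
  have "Poly_Mapping.keys ?d \<subseteq> M"
    using ab by (auto simp: in_keys_iff lookup_minus lookup_single when_def split: if_splits)
  then have keys: "Poly_Mapping.keys (x + l *\<^sub>R ?d) \<subseteq> M"
    using x by (intro keys_add_scaleR_subset) (auto simp: base_polytope_def)
  have cs: "coord_sum (x + l *\<^sub>R ?d) S =
      coord_sum x S + l * ((if a \<in> S then 1 else 0) - (if b \<in> S then 1 else 0))" if "S \<subseteq> M" for S
    using d[OF that] by simp
  have ge: "subset_count S \<le> coord_sum (x + l *\<^sub>R ?d) S" if "S \<subseteq> M" for S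
  proof (cases "S \<in> ?F")
    case True
    then show ?thesis using cs[OF that] l_le[OF True] by simp
  next
    case False
    have "subset_count S \<le> coord_sum x S" using x that by (simp add: base_polytope_def)
    with False show ?thesis using cs[OF that] that pos by auto
  qed
  have "x + l *\<^sub>R ?d \<in> base_polytope M"
    using keys ge cs[of M] x ab by (auto simp: base_polytope_def)
  moreover have "tight_sets M x \<subseteq> tight_sets M (x + l *\<^sub>R ?d)"
  proof
    fix S assume "S \<in> tight_sets M x"
    then show "S \<in> tight_sets M (x + l *\<^sub>R ?d)"
      using same[of S] cs[of S] by (auto simp: tight_sets_def)
  qed
  moreover have "S0 \<in> tight_sets M (x + l *\<^sub>R ?d)" 
    using S0 cs[of S0] by (auto simp: tight_sets_def)
  moreover have "S0 \<notin> tight_sets M x" using same[of S0] S0 by auto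
  ultimately show ?thesis using pos by blast
qed

text \<open>
  When the tight sets separate points, consecutive ones differ by single elements, so the tight
  equations determine every coordinate.
\<close>

lemma base_polytope_vertex:
  assumes M: "finite M" and x: "x \<in> base_polytope M"
    and separated: "\<And>a b. a \<in> M \<Longrightarrow> b \<in> M \<Longrightarrow> a \<noteq> b \<Longrightarrow> \<exists>S\<in>tight_sets M x. (a \<in> S) \<noteq> (b \<in> S)"
  shows "\<exists>r. x = center M r"
proof -
  obtain r where r: "tight_sets M x = downsets M r" using tight_sets_eq_downsets[OF M x] by blast
  have inj: "a = b" if abr: "a \<in> M" "b \<in> M" "r a = r b" for a b
  proof (rule ccontr)
    assume "a \<noteq> b"
    then obtain S where "S \<in> downsets M r" "(a \<in> S) \<noteq> (b \<in> S)" using separated[OF abr(1,2)] r by auto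
    then show False using abr unfolding downsets_def by force
  qed
  have y: "center M r \<in> base_polytope M" by (rule center_in_base_polytope[OF M])
  have agree: "coord_sum x S = coord_sum (center M r) S" if "S \<in> downsets M r" for S
  proof -
    have "S \<in> tight_sets M x" "S \<in> tight_sets M (center M r)"
      using that r tight_sets_center[OF M, of r] by auto
    then show ?thesis by (simp add: tight_sets_def)
  qed
  have "x = center M r"
  proof (rule poly_mapping_eqI)
    fix i
    show "Poly_Mapping.lookup x i = Poly_Mapping.lookup (center M r) i"
    proof (cases "i \<in> M")
      case True
      let ?A = "{j \<in> M. r j \<le> r i}" and ?B = "{j \<in> M. r j < r i}"
      have A: "?A = insert i ?B"
      proof (intro equalityI subsetI)
        fix j assume "j \<in> ?A"
        then show "j \<in> insert i ?B" using inj[of j i] True by (cases "r j = r i") auto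
      qed (use True in auto)
      have split: "coord_sum z ?A = Poly_Mapping.lookup z i + coord_sum z ?B" for z :: "'a \<Rightarrow>\<^sub>0 real"
        unfolding A coord_sum_def using M by (subst sum.insert) auto
      have "?A \<in> downsets M r" "?B \<in> downsets M r" by (auto simp: downsets_def)
      from agree[OF this(1)] agree[OF this(2)] show ?thesis
        using split[of x] split[of "center M r"] by linarith
    next
      case False
      then have "i \<notin> Poly_Mapping.keys x" "i \<notin> Poly_Mapping.keys (center M r)"
        using x y by (auto simp: base_polytope_def)
      then show ?thesis by (simp add: in_keys_iff)
    qed
  qed
  then show ?thesis by blast
qed

text \<open>
  Pushing weight between two unseparated elements in both directions writes \<open>x\<close> as a convex
  combination of points with strictly more tight sets; the process ends in vertices, which are
  centers and so belong to the Minkowski sum.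
\<close>

lemma base_polytope_subset_simplex_sum:
  assumes M: "finite M"
  shows "base_polytope M \<subseteq> simplex_sum M"
proof
  fix x :: "'a \<Rightarrow>\<^sub>0 real"
  assume "x \<in> base_polytope M"
  then show "x \<in> simplex_sum M"
  proof (induction "card (Pow M - tight_sets M x)" arbitrary: x rule: less_induct)
    case less
    show ?case
    proof (cases "\<exists>a\<in>M. \<exists>b\<in>M. a \<noteq> b \<and> (\<forall>S\<in>tight_sets M x. a \<in> S \<longleftrightarrow> b \<in> S)")
      case False
      then have "\<exists>r. x = center M r"
        by (intro base_polytope_vertex[OF M less.prems]) blast
      then obtain r where "x = center M r" ..
      then show ?thesis using center_in_simplex_sum[OF M] by simp
    next
      case True
      then obtain a b where ab: "a \<in> M" "b \<in> M" "a \<noteq> b"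
        and same: "\<And>S. S \<in> tight_sets M x \<Longrightarrow> a \<in> S \<longleftrightarrow> b \<in> S" by blast
      have IH: "y \<in> simplex_sum M" if "y \<in> base_polytope M" "tight_sets M x \<subset> tight_sets M y" for y
      proof (rule less.hyps[OF _ that(1)])
        have "tight_sets M y \<subseteq> Pow M" by (auto simp: tight_sets_def)
        with that(2) show "card (Pow M - tight_sets M y) < card (Pow M - tight_sets M x)"
          using M by (intro psubset_card_mono) auto
      qed
      obtain l where l: "l > 0" "x + l *\<^sub>R (unit_vec a - unit_vec b) \<in> simplex_sum M"
        using base_polytope_push[OF M less.prems ab same] IH by metis
      obtain k where k: "k > 0" "x + k *\<^sub>R (unit_vec b - unit_vec a) \<in> simplex_sum M"
        using base_polytope_push[OF M less.prems ab(2,1) ab(3)[symmetric] same[symmetric]] IH by metis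
      have one: "k / (k + l) + l / (k + l) = 1"
        using l(1) k(1) by (simp flip: add_divide_distrib)
      have "(k / (k + l)) *\<^sub>R (x + l *\<^sub>R (unit_vec a - unit_vec b)) +
          (l / (k + l)) *\<^sub>R (x + k *\<^sub>R (unit_vec b - unit_vec a)) \<in> simplex_sum M"
        using l(1) k(1) by (intro convexD[OF convex_simplex_sum l(2) k(2)] one) simp_all
      also have "(k / (k + l)) *\<^sub>R (x + l *\<^sub>R (unit_vec a - unit_vec b)) +
          (l / (k + l)) *\<^sub>R (x + k *\<^sub>R (unit_vec b - unit_vec a)) =
          (k / (k + l) + l / (k + l)) *\<^sub>R x"
        by (simp add: algebra_simps)
      finally show ?thesis by (simp only: one scaleR_one)
    qed
  qed
qed

theorem simplex_sum_eq_base_polytope: "finite M \<Longrightarrow> simplex_sum M = base_polytope M"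
  using simplex_sum_subset_base_polytope base_polytope_subset_simplex_sum by blast

section \<open>Counting surjections\<close>

text \<open>
  The numbers \<open>k! S(m,k)\<close> with \<open>S\<close> the Stirling numbers of the second kind, by the recurrence
  that \<open>card_surjections\<close> justifies.
\<close>

fun surj_num :: "nat \<Rightarrow> nat \<Rightarrow> nat" where
  "surj_num 0 k = (if k = 0 then 1 else 0)"
| "surj_num (Suc m) 0 = 0"
| "surj_num (Suc m) (Suc k) = Suc k * (surj_num m (Suc k) + surj_num m k)"

definition surjections :: "'a set \<Rightarrow> 'b set \<Rightarrow> ('a \<Rightarrow> 'b) set" where
  "surjections M K = {f \<in> M \<rightarrow>\<^sub>E K. f ` M = K}"

text \<open>
  Removing \<open>x\<close> from a surjection \<open>g\<close> leaves a map that is either still onto \<open>K\<close> or misses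
  exactly \<open>g x\<close>.
\<close>

lemma surjections_insert:
  assumes "x \<notin> M"
  shows "bij_betw (\<lambda>(y, f). f(x := y)) (SIGMA y:K. surjections M K \<union> surjections M (K - {y}))
    (surjections (insert x M) K)"
proof (rule bij_betw_byWitness[where f' = "\<lambda>g. (g x, g(x := undefined))"])
  show "\<forall>a\<in>SIGMA y:K. surjections M K \<union> surjections M (K - {y}).
      (\<lambda>g. (g x, g(x := undefined))) ((\<lambda>(y, f). f(x := y)) a) = a"
    using assms by (auto simp: surjections_def PiE_def extensional_def fun_eq_iff)
  show "\<forall>g\<in>surjections (insert x M) K.
      (\<lambda>(y, f). f(x := y)) ((\<lambda>g. (g x, g(x := undefined))) g) = g"
    by auto
  show "(\<lambda>(y, f). f(x := y)) ` (SIGMA y:K. surjections M K \<union> surjections M (K - {y}))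
      \<subseteq> surjections (insert x M) K"
  proof clarify
    fix y f assume y: "y \<in> K" and f: "f \<in> surjections M K \<union> surjections M (K - {y})"
    have "f(x := y) ` M = f ` M" using assms by (intro image_cong) auto
    then have "f(x := y) ` insert x M = insert y (f ` M)" by (simp only: image_insert fun_upd_same)
    moreover have "f \<in> M \<rightarrow>\<^sub>E K" "insert y (f ` M) = K"
      using y f by (auto simp: surjections_def PiE_iff)
    ultimately show "f(x := y) \<in> surjections (insert x M) K"
      using y assms unfolding surjections_def by (auto simp: PiE_iff extensional_def)
  qed
  show "(\<lambda>g. (g x, g(x := undefined))) ` surjections (insert x M) K
      \<subseteq> (SIGMA y:K. surjections M K \<union> surjections M (K - {y}))"
  proof clarify
    fix g assume g: "g \<in> surjections (insert x M) K"
    have im: "(g(x := undefined)) ` M = g ` M" using assms by (intro image_cong) auto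
    have ext: "g(x := undefined) \<in> extensional M" using g by (auto simp: surjections_def PiE_iff extensional_def)
    have "insert (g x) (g ` M) = K" using g by (auto simp: surjections_def)
    then have "g ` M = K \<or> g ` M = K - {g x}" by blast
    then show "g x \<in> K \<and> g(x := undefined) \<in> surjections M K \<union> surjections M (K - {g x})"
      using g im ext by (auto simp: surjections_def PiE_iff)
  qed
qed

lemma finite_surjections: "finite M \<Longrightarrow> finite K \<Longrightarrow> finite (surjections M K)"
  by (rule finite_subset[of _ "M \<rightarrow>\<^sub>E K"]) (auto simp: surjections_def intro: finite_PiE)

lemma card_surjections:
  assumes "finite M" "finite K"
  shows "card (surjections M K) = surj_num (card M) (card K)"
  using assms
proof (induction M arbitrary: K rule: finite_induct)
  case empty
  then show ?case by (auto simp: surjections_def)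
next
  case (insert x M)
  have "card (surjections (insert x M) K) =
      card (SIGMA y:K. surjections M K \<union> surjections M (K - {y}))"
    using bij_betw_same_card[OF surjections_insert[OF insert.hyps(2), of K]] by simp
  also have "\<dots> = (\<Sum>y\<in>K. card (surjections M K \<union> surjections M (K - {y})))"
    using insert finite_surjections[of M] by (intro card_SigmaI) auto
  also have "\<dots> = (\<Sum>y\<in>K. surj_num (card M) (card K) + surj_num (card M) (card K - 1))"
  proof (rule sum.cong[OF refl])
    fix y assume y: "y \<in> K"
    have "surjections M K \<inter> surjections M (K - {y}) = {}"
      using y by (auto simp: surjections_def)
    then have "card (surjections M K \<union> surjections M (K - {y})) =
        card (surjections M K) + card (surjections M (K - {y}))"
      using insert finite_surjections[of M] by (intro card_Un_disjoint) auto
    then show "card (surjections M K \<union> surjections M (K - {y})) =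
        surj_num (card M) (card K) + surj_num (card M) (card K - 1)"
      using insert y by simp
  qed
  also have "\<dots> = surj_num (card (insert x M)) (card K)"
    using insert by (cases "card K") auto
  finally show ?case .
qed

lemma surj_num_eq_0: "m < k \<Longrightarrow> surj_num m k = 0"
  by (induction m k rule: surj_num.induct) auto

lemma surj_num_Suc:
  "surj_num (Suc m) k = k * surj_num m k + k * surj_num m (k - 1)"
  by (cases k) (auto simp: algebra_simps)

text \<open>
  The Leibniz rule \<open>(FG)' = F'G + FG'\<close> for exponential generating functions.
\<close>

lemma binomial_convolution_Suc:
  fixes f g :: "nat \<Rightarrow> 'a::comm_semiring_1"
  shows "(\<Sum>i\<le>Suc n. of_nat (Suc n choose i) * (f i * g (Suc n - i))) =
    (\<Sum>i\<le>n. of_nat (n choose i) * (f (Suc i) * g (n - i))) +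
    (\<Sum>i\<le>n. of_nat (n choose i) * (f i * g (Suc (n - i))))"
proof -
  have "(\<Sum>i\<le>Suc n. of_nat (Suc n choose i) * (f i * g (Suc n - i))) =
     f 0 * g (Suc n) + (\<Sum>i\<le>n. of_nat (Suc n choose Suc i) * (f (Suc i) * g (n - i)))"
    by (subst sum.atMost_Suc_shift) simp
  also have "(\<Sum>i\<le>n. of_nat (Suc n choose Suc i) * (f (Suc i) * g (n - i))) =
     (\<Sum>i\<le>n. of_nat (n choose i) * (f (Suc i) * g (n - i))) +
     (\<Sum>i\<le>n. of_nat (n choose Suc i) * (f (Suc i) * g (n - i)))"
    by (simp add: distrib_right sum.distrib)
  also have "f 0 * g (Suc n) + (\<dots>) = (\<Sum>i\<le>n. of_nat (n choose i) * (f (Suc i) * g (n - i))) +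
     (f 0 * g (Suc n) + (\<Sum>i\<le>n. of_nat (n choose Suc i) * (f (Suc i) * g (n - i))))"
    by (simp add: algebra_simps)
  also have "f 0 * g (Suc n) + (\<Sum>i\<le>n. of_nat (n choose Suc i) * (f (Suc i) * g (n - i))) =
     (\<Sum>i\<le>Suc n. of_nat (n choose i) * (f i * g (Suc n - i)))"
    by (subst sum.atMost_Suc_shift) simp
  also have "\<dots> = (\<Sum>i\<le>n. of_nat (n choose i) * (f i * g (Suc (n - i))))"
    by (simp add: Suc_diff_le binomial_eq_0)
  finally show ?thesis .
qed

text \<open>
  In generating functions this is \<open>(e\<^sup>z - 1)\<^sup>l (e\<^sup>z - 1)\<^sup>p = (e\<^sup>z - 1)\<^sup>l\<^sup>+\<^sup>p\<close>: cutting an ordered partition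
  after its first \<open>l\<close> blocks.
\<close>

lemma surj_num_convolution:
  "(\<Sum>i\<le>n. (n choose i) * (surj_num i l * surj_num (n - i) p)) = surj_num n (l + p)"
proof (induction n arbitrary: l p)
  case 0
  then show ?case by simp
next
  case (Suc n)
  let ?b = "\<lambda>l p. \<Sum>i\<le>n. (n choose i) * (surj_num i l * surj_num (n - i) p)"
  have "(\<Sum>i\<le>Suc n. (Suc n choose i) * (surj_num i l * surj_num (Suc n - i) p)) =
      (\<Sum>i\<le>n. (n choose i) * (surj_num (Suc i) l * surj_num (n - i) p)) +
      (\<Sum>i\<le>n. (n choose i) * (surj_num i l * surj_num (Suc (n - i)) p))"
    using binomial_convolution_Suc[of n "\<lambda>i. surj_num i l" "\<lambda>i. surj_num i p"] by simp
  also have "\<dots> = l * (?b l p + ?b (l - 1) p) + p * (?b l p + ?b l (p - 1))"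
    by (simp add: surj_num_Suc sum_distrib_left sum.distrib[symmetric] algebra_simps)
  also have "\<dots> = surj_num (Suc n) (l + p)"
    unfolding Suc.IH surj_num_Suc by (cases l; cases p) (auto simp: algebra_simps)
  finally show ?case .
qed

section \<open>The faces of the base polytope\<close>

definition rank_face :: "'a set \<Rightarrow> ('a \<Rightarrow> nat) \<Rightarrow> ('a \<Rightarrow>\<^sub>0 real) set" where
  "rank_face M r = {x \<in> base_polytope M. downsets M r \<subseteq> tight_sets M x}"

lemma keys_diff_base_polytope:
  assumes "x \<in> base_polytope M" "y \<in> base_polytope M"
  shows "Poly_Mapping.keys (x - y) \<subseteq> M"
proof -
  have "Poly_Mapping.keys x \<subseteq> M" "Poly_Mapping.keys y \<subseteq> M"
    using assms by (simp_all add: base_polytope_def)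
  then show ?thesis by (intro order_trans[OF keys_diff]) simp
qed

lemma coord_sum_convex_eq_bound:
  fixes a b c u :: real
  assumes "(1 - u) * a + u * b = c" "c \<le> a" "c \<le> b" "0 < u" "u < 1"
  shows "a = c" "b = c"
proof -
  have "(1 - u) * (a - c) + u * (b - c) = 0" using assms(1) by (simp add: algebra_simps)
  moreover have "0 \<le> (1 - u) * (a - c)" "0 \<le> u * (b - c)" using assms by auto
  ultimately have "(1 - u) * (a - c) = 0" "u * (b - c) = 0" by linarith+
  then show "a = c" "b = c" using assms by auto
qed

lemma tight_sets_convex_comb:
  assumes "a \<in> base_polytope M" "b \<in> base_polytope M" "0 < u" "u < 1"
  shows "tight_sets M ((1 - u) *\<^sub>R a + u *\<^sub>R b) = tight_sets M a \<inter> tight_sets M b"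
proof (intro equalityI subsetI)
  fix S assume "S \<in> tight_sets M ((1 - u) *\<^sub>R a + u *\<^sub>R b)"
  then have S: "S \<subseteq> M" "(1 - u) * coord_sum a S + u * coord_sum b S = subset_count S"
    by (auto simp: tight_sets_def)
  have "subset_count S \<le> coord_sum a S" "subset_count S \<le> coord_sum b S"
    using assms S(1) by (auto simp: base_polytope_def)
  from coord_sum_convex_eq_bound[OF S(2) this assms(3,4)] S(1)
  show "S \<in> tight_sets M a \<inter> tight_sets M b" by (simp add: tight_sets_def)
next
  fix S assume "S \<in> tight_sets M a \<inter> tight_sets M b"
  then show "S \<in> tight_sets M ((1 - u) *\<^sub>R a + u *\<^sub>R b)"
    by (simp add: tight_sets_def algebra_simps)
qed

lemma convex_base_polytope: "finite M \<Longrightarrow> convex (base_polytope M)"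
  using convex_simplex_sum simplex_sum_eq_base_polytope by metis

lemma rank_face_face_of:
  assumes M: "finite M"
  shows "rank_face M r face_of base_polytope M"
  unfolding face_of_def
proof (intro conjI ballI impI)
  show "rank_face M r \<subseteq> base_polytope M" by (auto simp: rank_face_def)
  show "convex (rank_face M r)"
    unfolding convex_alt
  proof (intro ballI allI impI)
    fix x y and u :: real
    assume xy: "x \<in> rank_face M r" "y \<in> rank_face M r" and u: "0 \<le> u \<and> u \<le> 1"
    have "(1 - u) *\<^sub>R x + u *\<^sub>R y \<in> base_polytope M"
      using xy u convex_base_polytope[OF M] unfolding convex_alt by (auto simp: rank_face_def)
    moreover have "downsets M r \<subseteq> tight_sets M ((1 - u) *\<^sub>R x + u *\<^sub>R y)"
    proof
      fix S assume "S \<in> downsets M r"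
      then have "S \<in> tight_sets M x" "S \<in> tight_sets M y" using xy by (auto simp: rank_face_def)
      then show "S \<in> tight_sets M ((1 - u) *\<^sub>R x + u *\<^sub>R y)"
        by (simp add: tight_sets_def algebra_simps)
    qed
    ultimately show "(1 - u) *\<^sub>R x + u *\<^sub>R y \<in> rank_face M r" by (simp add: rank_face_def)
  qed
next
  fix a b x
  assume ab: "a \<in> base_polytope M" "b \<in> base_polytope M" and x: "x \<in> rank_face M r"
    and seg: "x \<in> open_segment a b"
  from seg obtain u where u: "0 < u" "u < 1" "x = (1 - u) *\<^sub>R a + u *\<^sub>R b"
    by (auto simp: in_segment)
  have "downsets M r \<subseteq> tight_sets M a \<inter> tight_sets M b"
    using x tight_sets_convex_comb[OF ab u(1,2)] u(3) by (simp add: rank_face_def)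
  then show "a \<in> rank_face M r" "b \<in> rank_face M r" using ab by (simp_all add: rank_face_def)
qed

text \<open>
  A point \<open>x0\<close> of \<open>F\<close> with as few tight sets as possible is relatively interior. Every point of
  \<open>F\<close> is tight wherever \<open>x0\<close> is, since their midpoint is tight only where both are, yet has by the
  choice of \<open>x0\<close> no fewer tight sets than \<open>x0\<close>.
  Conversely, if \<open>y\<close> is tight wherever \<open>x0\<close> is, the segment from \<open>y\<close> to \<open>x0\<close> can be prolonged
  beyond \<open>x0\<close> inside the polytope, so the face \<open>F\<close> contains \<open>y\<close>.
\<close>

lemma face_of_base_polytope_imp_rank_face:
  assumes M: "finite M" and F: "F face_of base_polytope M" "F \<noteq> {}"
  shows "\<exists>r. F = rank_face M r"
proof -
  have FP: "F \<subseteq> base_polytope M" and "convex F" using F by (auto simp: face_of_def)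
  obtain x0 where x0: "x0 \<in> F"
    and least: "\<And>y. y \<in> F \<Longrightarrow> card (tight_sets M x0) \<le> card (tight_sets M y)"
  proof -
    from F(2) obtain x where "x \<in> F" by blast
    from ex_has_least_nat[of "\<lambda>x. x \<in> F", OF this, of "\<lambda>x. card (tight_sets M x)"]
    show ?thesis using that by blast
  qed
  have x0P: "x0 \<in> base_polytope M" using x0 FP by blast
  obtain r where r: "tight_sets M x0 = downsets M r" using tight_sets_eq_downsets[OF M x0P] by blast
  have fin: "finite (tight_sets M x0)"
    by (rule finite_subset[of _ "Pow M"]) (auto simp: tight_sets_def M)
  have "F = rank_face M r"
  proof (intro equalityI subsetI)
    fix y assume y: "y \<in> F"
    then have yP: "y \<in> base_polytope M" using FP by blast
    let ?z = "(1 - 1/2) *\<^sub>R x0 + (1/2::real) *\<^sub>R y"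
    have "?z \<in> F" using convexD_alt[OF \<open>convex F\<close> x0 y, of "1/2"] by simp
    from least[OF this] have "card (tight_sets M x0) \<le> card (tight_sets M x0 \<inter> tight_sets M y)"
      using tight_sets_convex_comb[OF x0P yP, of "1/2"] by simp
    then have "tight_sets M x0 \<inter> tight_sets M y = tight_sets M x0"
      using fin by (intro card_seteq) auto
    then show "y \<in> rank_face M r" using yP r by (auto simp: rank_face_def)
  next
    fix y assume y: "y \<in> rank_face M r"
    then have yP: "y \<in> base_polytope M" and yt: "tight_sets M x0 \<subseteq> tight_sets M y"
      using r by (auto simp: rank_face_def)
    show "y \<in> F"
    proof (cases "y = x0")
      case False
      have keys: "Poly_Mapping.keys (x0 - y) \<subseteq> M"
        by (rule keys_diff_base_polytope[OF x0P yP])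
      have "coord_sum (x0 - y) S = 0" if "S \<in> tight_sets M x0" for S
      proof -
        have "S \<in> tight_sets M y" using that yt by blast
        with that show ?thesis by (simp add: tight_sets_def)
      qed
      from base_polytope_perturb[OF M x0P keys this]
      obtain e where e: "e > 0" "x0 + e *\<^sub>R (x0 - y) \<in> base_polytope M" by blast
      let ?z = "x0 + e *\<^sub>R (x0 - y)"
      \<comment> \<open>The ratio at which \<open>x0\<close> divides the segment from \<open>y\<close> to the prolonged end.\<close>
      define u where "u = 1 / (1 + e)"
      have u: "0 < u" "u < 1" using e(1) by (simp_all add: u_def)
      have "u * (1 + e) = 1" using e(1) by (simp add: u_def)
      then have ue: "u * e = 1 - u" by (simp add: distrib_left)
      have "(1 - u) *\<^sub>R y + u *\<^sub>R ?z = (1 - u) *\<^sub>R y + u *\<^sub>R x0 + (u * e) *\<^sub>R (x0 - y)"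
        by (simp only: scaleR_add_right scaleR_scaleR add.assoc)
      also have "\<dots> = x0" unfolding ue by (simp add: algebra_simps)
      finally have comb: "x0 = (1 - u) *\<^sub>R y + u *\<^sub>R ?z" by (rule sym)
      have "?z - y = (1 + e) *\<^sub>R (x0 - y)"
        by (simp only: scaleR_add_left scaleR_one add_diff_eq diff_add_eq)
      also have "\<dots> \<noteq> 0" using e(1) False by simp
      finally have "y \<noteq> ?z" unfolding right_minus_eq by (rule not_sym)
      then have "x0 \<in> open_segment y ?z"
        using in_segment(2)[of x0 y ?z] u comb by blast
      from face_ofD[OF F(1) this yP e(2) x0] show ?thesis ..
    qed (use x0 in simp)
  qed
  then show ?thesis by blast
qed

lemma center_in_rank_face: "finite M \<Longrightarrow> center M r \<in> rank_face M r"
  by (simp add: rank_face_def center_in_base_polytope tight_sets_center)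

text \<open>
  The chain is recovered from the face as the tight sets of its center.
\<close>

lemma rank_face_eq_imp_downsets_eq:
  assumes "finite M" "rank_face M r = rank_face M r'"
  shows "downsets M r = downsets M r'"
proof
  have "center M r \<in> rank_face M r'" "center M r' \<in> rank_face M r"
    using center_in_rank_face[OF assms(1)] assms(2) by metis+
  then show "downsets M r' \<subseteq> downsets M r" "downsets M r \<subseteq> downsets M r'"
    by (simp_all add: rank_face_def tight_sets_center[OF assms(1)])
qed

lemma downsets_eq_imp_le_iff:
  assumes eq: "downsets M r = downsets M r'" and ij: "i \<in> M" "j \<in> M"
  shows "r j \<le> r i \<longleftrightarrow> r' j \<le> r' i"
proof -
  have *: "s j \<le> s i \<longleftrightarrow> (\<forall>S\<in>downsets M s. i \<in> S \<longrightarrow> j \<in> S)" for s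
  proof
    assume sub: "\<forall>S\<in>downsets M s. i \<in> S \<longrightarrow> j \<in> S"
    have "{l \<in> M. s l \<le> s i} \<in> downsets M s" by (auto simp: downsets_def)
    from bspec[OF sub this] show "s j \<le> s i" using ij by simp
  next
    assume "s j \<le> s i"
    then show "\<forall>S\<in>downsets M s. i \<in> S \<longrightarrow> j \<in> S"
      using ij(2) unfolding downsets_def by blast
  qed
  show ?thesis using *[of r] *[of r'] eq by simp
qed

text \<open>
  An initial segment of the natural numbers has only one order isomorphism to an initial segment.
\<close>

lemma surjections_eqI:
  fixes r r' :: "'a \<Rightarrow> nat"
  assumes r: "r \<in> surjections M {..<k}" and r': "r' \<in> surjections M {..<k'}"
    and le_iff: "\<And>i j. i \<in> M \<Longrightarrow> j \<in> M \<Longrightarrow> r j \<le> r i \<longleftrightarrow> r' j \<le> r' i"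
  shows "r = r'"
proof -
  have im: "r ` M = {..<k}" "r' ` M = {..<k'}" using r r' by (auto simp: surjections_def)
  have main: "\<forall>i\<in>M. r i = n \<longrightarrow> r' i = n" for n
  proof (induction n rule: less_induct)
    case (less n)
    show ?case
    proof (intro ballI impI)
      fix i assume i: "i \<in> M" "r i = n"
      show "r' i = n"
      proof (rule ccontr)
        assume "r' i \<noteq> n"
        then consider "n < r' i" | "r' i < n" by linarith
        then show False
        proof cases
          case 1
          have "r' i < k'" using im(2) i(1) by blast
          then have "n \<in> r' ` M" using im(2) 1 by auto
          then obtain j where j: "j \<in> M" "r' j = n" by auto
          then have "r j < n" using 1 le_iff[OF j(1) i(1)] i(2) by simp
          then have "r' j = r j" using less j(1) by blast
          with j \<open>r j < n\<close> show False by simp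
        next
          case 2
          have "n < k" using im(1) i by blast
          then have "r' i \<in> r ` M" using im(1) 2 by auto
          then obtain j where j: "j \<in> M" "r j = r' i" by auto
          then have "r' j = r' i" using less[of "r' i"] 2 by auto
          then have "r i \<le> r j" using le_iff[OF j(1) i(1)] by simp
          with j 2 i(2) show False by simp
        qed
      qed
    qed
  qed
  show ?thesis
  proof
    fix i show "r i = r' i"
    proof (cases "i \<in> M")
      case True
      then show ?thesis using main[of "r i"] by simp
    next
      case False
      then show ?thesis using r r' by (auto simp: surjections_def PiE_def extensional_def)
    qed
  qed
qed

lemma exists_surjection_downsets_eq:
  assumes M: "finite M"
  shows "\<exists>k. \<exists>r'\<in>surjections M {..<k}. downsets M r' = downsets M r"
proof -
  let ?A = "r ` M"
  \<comment> \<open>Compressing the values of \<open>r\<close> to an initial segment keeps the weak order.\<close>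
  define \<phi> where "\<phi> a = card {b \<in> ?A. b < a}" for a
  have finA: "finite ?A" using M by simp
  have mono: "\<phi> a < \<phi> b" if "a \<in> ?A" "a < b" for a b
    unfolding \<phi>_def using finA that by (intro psubset_card_mono) auto
  have le_iff: "\<phi> a \<le> \<phi> b \<longleftrightarrow> a \<le> b" if "a \<in> ?A" "b \<in> ?A" for a b
    using mono[of a b] mono[of b a] that by (cases a b rule: linorder_cases) auto
  have inj: "inj_on \<phi> ?A" by (intro inj_onI) (metis le_iff order_antisym order_refl)
  have "\<phi> ` ?A \<subseteq> {..<card ?A}"
    unfolding \<phi>_def using finA by (auto intro!: psubset_card_mono)
  then have im: "\<phi> ` ?A = {..<card ?A}"
    using card_image[OF inj] by (intro card_subset_eq) auto
  let ?r = "restrict (\<lambda>i. \<phi> (r i)) M"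
  have "?r ` M = {..<card ?A}" using im by (simp add: image_image)
  then have "?r \<in> surjections M {..<card ?A}" by (auto simp: surjections_def)
  moreover have "downsets M ?r = downsets M r"
    unfolding downsets_def using le_iff by (intro Collect_cong conj_cong refl ball_cong) (auto simp: subset_iff)
  ultimately show ?thesis by blast
qed

text \<open>
  Differences of points of the face span the vectors supported in \<open>M\<close> whose coordinates sum to
  zero over each of the \<open>k\<close> blocks \<open>r -` {j}\<close>. A representative \<open>s j\<close> of each block being chosen, the vectors
  \<open>unit_vec a - unit_vec (s (r a))\<close> for the remaining \<open>a\<close> form a basis.
\<close>

lemma affine_dim_rank_face:
  fixes M :: "'a set"
  assumes M: "finite M" and r: "r \<in> surjections M {..<k}"
  shows "affine_dim (rank_face M r) = card M - k"
proof -
  define s where "s = inv_into M r"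
  have im: "r ` M = {..<k}" using r by (simp add: surjections_def)
  have lt: "r a < k" if "a \<in> M" for a using that im by blast
  have s: "s j \<in> M" "r (s j) = j" if "j < k" for j
    using that im unfolding s_def by (simp_all add: inv_into_into f_inv_into_f)
  define N where "N = M - s ` {..<k}"
  define v where "v a = (unit_vec a - unit_vec (s (r a)) :: 'a \<Rightarrow>\<^sub>0 real)" for a
  let ?B = "v ` N" and ?D = "{x - y | x y. x \<in> rank_face M r \<and> y \<in> rank_face M r}"
  have finN: "finite N" using M by (simp add: N_def)
  have "inj_on s {..<k}" by (rule inj_onI) (metis s(2) lessThan_iff)
  then have "card (s ` {..<k}) = k" by (simp add: card_image)
  then have cardN: "card N = card M - k"
    unfolding N_def using s(1) by (subst card_Diff_subset) auto
  have lookup_v: "Poly_Mapping.lookup (v a) b = (if a = b then 1 else 0)" if "a \<in> N" "b \<in> N" for a b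
  proof -
    have "s (r a) \<noteq> b" using that lt by (auto simp: N_def)
    then show ?thesis by (simp add: v_def lookup_minus lookup_single when_def)
  qed
  have inj: "inj_on v N"
    by (rule inj_onI) (metis lookup_v zero_neq_one)
  have "independent ?B"
  proof
    assume "dependent ?B"
    then obtain u where u: "(\<Sum>w\<in>?B. u w *\<^sub>R w) = 0" and nz: "\<exists>w\<in>?B. u w \<noteq> 0"
      using dependent_finite[of ?B] finN by auto
    have "u (v a) = 0" if a: "a \<in> N" for a
    proof -
      have "0 = Poly_Mapping.lookup (\<Sum>w\<in>?B. u w *\<^sub>R w) a" using u by simp
      also have "\<dots> = (\<Sum>b\<in>N. u (v b) * Poly_Mapping.lookup (v b) a)"
        by (simp add: sum.reindex[OF inj] lookup_sum)
      also have "\<dots> = (\<Sum>b\<in>N. if b = a then u (v b) else 0)"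
        using a by (intro sum.cong) (auto simp: lookup_v)
      finally show ?thesis using a finN by simp
    qed
    with nz show False by auto
  qed
  moreover have "?D \<subseteq> span ?B"
  proof
    fix d assume "d \<in> ?D"
    then obtain x y where d: "d = x - y" and xy: "x \<in> rank_face M r" "y \<in> rank_face M r" by auto
    have keys: "Poly_Mapping.keys d \<subseteq> M"
      unfolding d using xy by (intro keys_diff_base_polytope) (simp_all add: rank_face_def)
    have flat: "coord_sum d S = 0" if "S \<in> downsets M r" for S
    proof -
      have "S \<in> tight_sets M x" "S \<in> tight_sets M y"
        using that xy by (auto simp: rank_face_def)
      then show ?thesis by (simp add: d tight_sets_def)
    qed
    have block: "coord_sum d {a \<in> M. r a = j} = 0" for j
    proof -
      have "coord_sum d ({a \<in> M. r a = j} \<union> {a \<in> M. r a < j}) =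
          coord_sum d {a \<in> M. r a = j} + coord_sum d {a \<in> M. r a < j}"
        unfolding coord_sum_def using M by (intro sum.union_disjoint) auto
      moreover have "{a \<in> M. r a = j} \<union> {a \<in> M. r a < j} \<in> downsets M r" "{a \<in> M. r a < j} \<in> downsets M r"
        by (auto simp: downsets_def)
      ultimately show ?thesis using flat by simp
    qed
    \<comment> \<open>Subtracting this vanishing sum expresses \<open>d\<close> through the vectors \<open>v a\<close>.\<close>
    have reps: "(\<Sum>a\<in>M. Poly_Mapping.lookup d a *\<^sub>R unit_vec (s (r a))) = 0"
    proof (rule poly_mapping_eqI)
      fix i
      have "Poly_Mapping.lookup (\<Sum>a\<in>M. Poly_Mapping.lookup d a *\<^sub>R unit_vec (s (r a))) i =
          (\<Sum>a\<in>M. if s (r a) = i then Poly_Mapping.lookup d a else 0)"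
        unfolding lookup_sum by (intro sum.cong) (auto simp: lookup_single when_def)
      also have "\<dots> = coord_sum d {a \<in> M. s (r a) = i}"
        unfolding coord_sum_def using M by (simp add: sum.inter_filter)
      also have "{a \<in> M. s (r a) = i} = (if i \<in> s ` {..<k} then {a \<in> M. r a = r i} else {})"
      proof (cases "i \<in> s ` {..<k}")
        case True
        then obtain j where j: "j < k" "i = s j" by auto
        then show ?thesis using s(2) lt by (auto, metis)
      qed (use lt in auto)
      finally show "Poly_Mapping.lookup (\<Sum>a\<in>M. Poly_Mapping.lookup d a *\<^sub>R unit_vec (s (r a))) i =
          Poly_Mapping.lookup 0 i" using block by (auto split: if_splits)
    qed
    have "d = (\<Sum>a\<in>M. Poly_Mapping.lookup d a *\<^sub>R unit_vec a)"
    proof (rule poly_mapping_eqI)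
      fix i
      have "Poly_Mapping.lookup (\<Sum>a\<in>M. Poly_Mapping.lookup d a *\<^sub>R unit_vec a) i =
          (\<Sum>a\<in>M. if a = i then Poly_Mapping.lookup d a else 0)"
        unfolding lookup_sum by (intro sum.cong) (auto simp: lookup_single when_def)
      also have "\<dots> = Poly_Mapping.lookup d i"
        using M keys by (auto simp: in_keys_iff)
      finally show "Poly_Mapping.lookup d i =
          Poly_Mapping.lookup (\<Sum>a\<in>M. Poly_Mapping.lookup d a *\<^sub>R unit_vec a) i" by simp
    qed
    then have "d = (\<Sum>a\<in>M. Poly_Mapping.lookup d a *\<^sub>R unit_vec a) -
        (\<Sum>a\<in>M. Poly_Mapping.lookup d a *\<^sub>R unit_vec (s (r a)))" using reps by simp
    also have "\<dots> = (\<Sum>a\<in>M. Poly_Mapping.lookup d a *\<^sub>R v a)"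
      by (simp add: v_def scaleR_diff_right sum_subtractf)
    also have "\<dots> \<in> span ?B"
    proof (intro span_sum span_scale)
      fix a assume a: "a \<in> M"
      show "v a \<in> span ?B"
      proof (cases "a \<in> N")
        case False
        then have "s (r a) = a" using a s(2) by (auto simp: N_def)
        then show ?thesis by (simp add: v_def span_zero)
      qed (auto intro: span_base)
    qed
    finally show "d \<in> span ?B" .
  qed
  moreover have "?B \<subseteq> span ?D"
  proof
    fix w assume "w \<in> ?B"
    then obtain a where a: "a \<in> M" "w = v a" by (auto simp: N_def)
    let ?c = "center M r"
    have sa: "s (r a) \<in> M" "r (s (r a)) = r a" using s lt a by auto
    have keys: "Poly_Mapping.keys w \<subseteq> M"
      using a sa by (auto simp: v_def in_keys_iff lookup_minus lookup_single when_def split: if_splits)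
    have flat: "coord_sum w S = 0" if "S \<in> downsets M r" for S
    proof -
      have "finite S" "a \<in> S \<longleftrightarrow> s (r a) \<in> S"
        using that a sa M finite_subset unfolding downsets_def by auto
      then show ?thesis by (simp add: a v_def coord_sum_single)
    qed
    then obtain e where e: "e > 0" "?c + e *\<^sub>R w \<in> base_polytope M"
      using base_polytope_perturb[OF M center_in_base_polytope[OF M] keys] tight_sets_center[OF M]
      by metis
    have "?c + e *\<^sub>R w \<in> rank_face M r"
      using e(2) flat tight_sets_center[OF M, of r] unfolding rank_face_def
      by (auto simp: tight_sets_def set_eq_iff)
    then have "(?c + e *\<^sub>R w) - ?c \<in> ?D" using center_in_rank_face[OF M] by blast
    then have "(1 / e) *\<^sub>R ((?c + e *\<^sub>R w) - ?c) \<in> span ?D" by (intro span_scale span_base)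
    then show "w \<in> span ?D" using e(1) by simp
  qed
  ultimately have "dim ?D = card ?B"
    by (intro dim_eq_card) (simp_all add: span_eq)
  then show ?thesis
    unfolding affine_dim_def by (simp add: card_image[OF inj] cardN)
qed

lemma surjections_card_le: "finite M \<Longrightarrow> r \<in> surjections M {..<k} \<Longrightarrow> k \<le> card M"
  using card_image_le[of M r] by (simp add: surjections_def)

theorem face_number_simplex_sum:
  assumes M: "finite M" and i: "i \<le> card M"
  shows "face_number (simplex_sum M) i = surj_num (card M) (card M - i)"
proof -
  let ?R = "surjections M {..<card M - i}"
  have "{F. F face_of base_polytope M \<and> F \<noteq> {} \<and> affine_dim F = i} = rank_face M ` ?R"
  proof (intro equalityI subsetI)
    fix F assume "F \<in> {F. F face_of base_polytope M \<and> F \<noteq> {} \<and> affine_dim F = i}"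
    then have F: "F face_of base_polytope M" "F \<noteq> {}" "affine_dim F = i" by auto
    obtain r0 where r0: "F = rank_face M r0"
      using face_of_base_polytope_imp_rank_face[OF M F(1,2)] by blast
    obtain k r where r: "r \<in> surjections M {..<k}" "downsets M r = downsets M r0"
      using exists_surjection_downsets_eq[OF M] by blast
    have Fr: "F = rank_face M r" using r0 r(2) by (simp add: rank_face_def)
    have "k = card M - i"
      using affine_dim_rank_face[OF M r(1)] F(3) Fr surjections_card_le[OF M r(1)] by simp
    with Fr r(1) show "F \<in> rank_face M ` ?R" by blast
  next
    fix F assume "F \<in> rank_face M ` ?R"
    then obtain r where r: "r \<in> ?R" "F = rank_face M r" by blast
    then have "affine_dim F = i" using affine_dim_rank_face[OF M r(1)] i by simp
    then show "F \<in> {F. F face_of base_polytope M \<and> F \<noteq> {} \<and> affine_dim F = i}"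
      using rank_face_face_of[OF M, of r] center_in_rank_face[OF M, of r] r(2) by auto
  qed
  moreover have "inj_on (rank_face M) ?R"
  proof (rule inj_onI)
    fix r r' assume R: "r \<in> ?R" "r' \<in> ?R" and eq: "rank_face M r = rank_face M r'"
    show "r = r'"
      by (rule surjections_eqI[OF R])
         (rule downsets_eq_imp_le_iff[OF rank_face_eq_imp_downsets_eq[OF M eq]])
  qed
  ultimately show ?thesis
    unfolding face_number_def simplex_sum_eq_base_polytope[OF M]
    by (simp add: card_image card_surjections[OF M])
qed

lemma affine_dim_simplex_sum:
  assumes M: "finite M" "M \<noteq> {}"
  shows "affine_dim (simplex_sum M) = card M - 1"
proof -
  let ?r = "restrict (\<lambda>_. 0::nat) M"
  have r: "?r \<in> surjections M {..<1}" using M(2) by (auto simp: surjections_def)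
  have "downsets M ?r \<subseteq> {{}, M}" by (auto simp: downsets_def)
  then have "rank_face M ?r = base_polytope M"
    by (auto simp: rank_face_def base_polytope_def tight_sets_def)
  then show ?thesis
    using affine_dim_rank_face[OF M(1) r] simplex_sum_eq_base_polytope[OF M(1)] by simp
qed

section \<open>A quadratic recurrence for surjection polynomials\<close>

text \<open>
  The homogenized ordered Bell polynomials.
\<close>

definition surj_poly :: "nat \<Rightarrow> 'a::comm_ring_1 \<Rightarrow> 'a \<Rightarrow> 'a" where
  "surj_poly m x t = (\<Sum>k\<le>m. of_nat (surj_num m k) * x ^ (m - k) * t ^ k)"

lemma surj_poly_extend:
  assumes "m \<le> n"
  shows "surj_poly m x t = (\<Sum>k\<le>n. of_nat (surj_num m k) * x ^ (m - k) * t ^ k)"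
  unfolding surj_poly_def using assms
  by (intro sum.mono_neutral_left) (auto simp: surj_num_eq_0)

text \<open>
  The square of the generating function counts ordered partitions cut into an initial and a final
  part; \<open>k\<close> blocks can be cut at \<open>k + 1\<close> places.
\<close>

lemma surj_poly_convolution:
  fixes x t :: "'a::comm_ring_1"
  shows "(\<Sum>i\<le>n. of_nat (n choose i) * (surj_poly i x t * surj_poly (n - i) x t)) =
    (\<Sum>k\<le>n. of_nat (Suc k * surj_num n k) * x ^ (n - k) * t ^ k)"
proof -
  let ?a = "\<lambda>m k. of_nat (surj_num m k) :: 'a"
  have summand: "?a i l * x ^ (i - l) * t ^ l * (?a (n - i) p * x ^ (n - i - p) * t ^ p) =
      ?a i l * ?a (n - i) p * (x ^ (n - (l + p)) * t ^ (l + p))" if "i \<le> n" for i l p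
  proof (cases "l \<le> i \<and> p \<le> n - i")
    case True
    with that have "n - (l + p) = (i - l) + (n - i - p)" by arith
    then show ?thesis by (simp add: power_add algebra_simps)
  next
    case False
    then have "?a i l = 0 \<or> ?a (n - i) p = 0" by (auto simp: surj_num_eq_0)
    then show ?thesis by auto
  qed
  have zero: "l + p \<le> n" if "?a n (l + p) * (x ^ (n - (l + p)) * t ^ (l + p)) \<noteq> 0" for l p
    using that surj_num_eq_0[of n "l + p"] by (metis mult_zero_left not_le of_nat_0)
  have "(\<Sum>i\<le>n. of_nat (n choose i) * (surj_poly i x t * surj_poly (n - i) x t)) =
      (\<Sum>i\<le>n. of_nat (n choose i) * (\<Sum>l\<le>n. \<Sum>p\<le>n.
        ?a i l * ?a (n - i) p * (x ^ (n - (l + p)) * t ^ (l + p))))"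
  proof (intro sum.cong refl arg_cong2[where f = "(*)"])
    fix i assume "i \<in> {..n}"
    then have i: "i \<le> n" by simp
    show "surj_poly i x t * surj_poly (n - i) x t =
        (\<Sum>l\<le>n. \<Sum>p\<le>n. ?a i l * ?a (n - i) p * (x ^ (n - (l + p)) * t ^ (l + p)))"
      unfolding surj_poly_extend[OF i] surj_poly_extend[OF diff_le_self] sum_product
      by (intro sum.cong refl summand[OF i])
  qed
  also have "\<dots> = (\<Sum>i\<le>n. \<Sum>l\<le>n. \<Sum>p\<le>n.
      of_nat (n choose i) * (?a i l * ?a (n - i) p) * (x ^ (n - (l + p)) * t ^ (l + p)))"
    by (simp add: sum_distrib_left mult.assoc)
  also have "\<dots> = (\<Sum>l\<le>n. \<Sum>i\<le>n. \<Sum>p\<le>n.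
      of_nat (n choose i) * (?a i l * ?a (n - i) p) * (x ^ (n - (l + p)) * t ^ (l + p)))"
    by (rule sum.swap)
  also have "\<dots> = (\<Sum>l\<le>n. \<Sum>p\<le>n. \<Sum>i\<le>n.
      of_nat (n choose i) * (?a i l * ?a (n - i) p) * (x ^ (n - (l + p)) * t ^ (l + p)))"
    by (intro sum.cong refl sum.swap)
  also have "\<dots> = (\<Sum>l\<le>n. \<Sum>p\<le>n. ?a n (l + p) * (x ^ (n - (l + p)) * t ^ (l + p)))"
    unfolding surj_num_convolution[symmetric, of n] by (simp add: sum_distrib_right)
  also have "\<dots> = (\<Sum>(l, p)\<in>{..n} \<times> {..n}. ?a n (l + p) * (x ^ (n - (l + p)) * t ^ (l + p)))"
    by (simp add: sum.cartesian_product)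
  also have "\<dots> = (\<Sum>(l, p)\<in>{(l, p). l + p \<le> n}. ?a n (l + p) * (x ^ (n - (l + p)) * t ^ (l + p)))"
    using zero by (intro sum.mono_neutral_right) auto
  also have "\<dots> = (\<Sum>k\<le>n. \<Sum>l\<le>k. ?a n (l + (k - l)) * (x ^ (n - (l + (k - l))) * t ^ (l + (k - l))))"
    by (rule sum.triangle_reindex_eq)
  also have "\<dots> = (\<Sum>k\<le>n. of_nat (Suc k * surj_num n k) * x ^ (n - k) * t ^ k)"
    by (intro sum.cong refl) (simp add: algebra_simps)
  finally show ?thesis .
qed

text \<open>
  The differential equation \<open>G' = (x + t) G\<^sup>2 - x G\<close> of the generating function. A new element
  forms a block of its own between two parts (\<open>t G\<^sup>2\<close>), or joins one of the \<open>k\<close> blocks: that is the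
  number of cuts minus one (\<open>x G\<^sup>2 - x G\<close>).
\<close>

lemma surj_poly_Suc:
  fixes x t :: "'a::comm_ring_1"
  shows "surj_poly (Suc n) x t = (x + t) *
    (\<Sum>i\<le>n. of_nat (n choose i) * (surj_poly i x t * surj_poly (n - i) x t)) - x * surj_poly n x t"
proof -
  let ?T = "\<Sum>k\<le>n. of_nat (k * surj_num n k) * x ^ (n - k) * t ^ k"
  let ?K = "\<Sum>k\<le>n. of_nat (Suc k * surj_num n k) * x ^ (n - k) * t ^ k"
  have K: "?K = ?T + surj_poly n x t"
    unfolding surj_poly_def by (simp add: sum.distrib[symmetric] algebra_simps)
  have "surj_poly (Suc n) x t =
      (\<Sum>k\<le>Suc n. of_nat (k * surj_num n k) * x ^ (Suc n - k) * t ^ k) +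
      (\<Sum>k\<le>Suc n. of_nat (k * surj_num n (k - 1)) * x ^ (Suc n - k) * t ^ k)"
    unfolding surj_poly_def surj_num_Suc by (simp only: of_nat_add distrib_right sum.distrib)
  also have "(\<Sum>k\<le>Suc n. of_nat (k * surj_num n k) * x ^ (Suc n - k) * t ^ k) =
      (\<Sum>k\<le>n. of_nat (k * surj_num n k) * x ^ (Suc n - k) * t ^ k)"
    by (simp add: surj_num_eq_0)
  also have "\<dots> = x * ?T"
    unfolding sum_distrib_left by (intro sum.cong refl) (simp add: Suc_diff_le algebra_simps)
  also have "(\<Sum>k\<le>Suc n. of_nat (k * surj_num n (k - 1)) * x ^ (Suc n - k) * t ^ k) = t * ?K"
    unfolding sum_distrib_left by (subst sum.atMost_Suc_shift) (simp add: mult_ac)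
  finally show ?thesis
    unfolding surj_poly_convolution K by (simp add: algebra_simps)
qed

lemma surj_poly_0 [simp]: "surj_poly 0 x t = 1"
  by (simp add: surj_poly_def)

lemma surj_poly_recurrence:
  fixes x t :: "'a::comm_ring_1"
  assumes "n \<ge> 1"
  shows "surj_poly (Suc n) x t = (x + 2 * t) * surj_poly n x t +
    (x + t) * (\<Sum>i = 1..n - 1. of_nat (n choose i) * (surj_poly i x t * surj_poly (n - i) x t))"
proof -
  let ?f = "\<lambda>i. of_nat (n choose i) * (surj_poly i x t * surj_poly (n - i) x t)"
  have "{..n} = insert 0 (insert n {1..n - 1})" using assms by auto
  then have "(\<Sum>i\<le>n. ?f i) = 2 * surj_poly n x t + (\<Sum>i = 1..n - 1. ?f i)"
    using assms by simp
  then show ?thesis unfolding surj_poly_Suc by (simp add: algebra_simps)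
qed

section \<open>The polynomial H of the permutohedron\<close>

lemma permutohedron_eq_simplex_sum: "permutohedron n = simplex_sum {1..n + 1}"
proof -
  have "connected_on (complete_graph (n + 1)) S" if "S \<subseteq> {1..n + 1}" for S
    unfolding connected_on_def
  proof (intro ballI)
    fix i j assume "i \<in> S" "j \<in> S"
    then show "(i, j) \<in> (complete_graph (n + 1) \<inter> S \<times> S)\<^sup>*"
      using that by (cases "i = j") (auto simp: complete_graph_def intro!: r_into_rtrancl)
  qed
  then have "building_set (n + 1) (complete_graph (n + 1)) = Pow {1..n + 1} - {{}}"
    by (auto simp: building_set_def)
  then show ?thesis
    by (simp add: permutohedron_def graph_associahedron_def simplex_sum_def)
qed

lemma affine_dim_permutohedron: "affine_dim (permutohedron n) = n"
  by (simp add: permutohedron_eq_simplex_sum affine_dim_simplex_sum)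

lemma pcompose_power: "pcompose (p ^ k) q = pcompose p q ^ k"
  for p q :: "'a::comm_ring_1 poly"
  by (induction k) (simp_all add: pcompose_mult pcompose_1)

lemma pcompose_of_nat: "pcompose (of_nat k) q = of_nat k"
  for q :: "'a::comm_ring_1 poly"
  by (simp add: of_nat_poly)

text \<open>
  The factor \<open>t\<close> turns the codimension \<open>n - i\<close> of a face into its number of blocks.
\<close>

lemma H_poly_permutohedron:
  "var_t * H_poly (permutohedron n) = surj_poly (Suc n) (var_alpha - var_t) var_t"
proof -
  have face: "face_number (permutohedron n) i = surj_num (Suc n) (Suc n - i)" if "i \<le> n" for i
    using that face_number_simplex_sum[of "{1..n + 1}" i] by (simp add: permutohedron_eq_simplex_sum)
  have "pcompose var_alpha (var_alpha - var_t) = var_alpha - var_t"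
    "pcompose var_t (var_alpha - var_t) = var_t"
    by (simp_all add: var_alpha_def var_t_def pcompose_pCons)
  then have "H_poly (permutohedron n) = (\<Sum>i\<le>n. of_nat (surj_num (Suc n) (Suc n - i)) *
      (var_alpha - var_t) ^ i * var_t ^ (n - i))"
    unfolding H_poly_def F_poly_def affine_dim_permutohedron
    by (simp add: pcompose_sum pcompose_mult pcompose_power pcompose_of_nat face)
  then have "var_t * H_poly (permutohedron n) = (\<Sum>i\<le>n. of_nat (surj_num (Suc n) (Suc n - i)) *
      (var_alpha - var_t) ^ i * var_t ^ (Suc n - i))"
    by (simp add: sum_distrib_left Suc_diff_le mult_ac)
  also have "\<dots> = (\<Sum>k=1..Suc n. of_nat (surj_num (Suc n) k) *
      (var_alpha - var_t) ^ (Suc n - k) * var_t ^ k)"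
    by (rule sum.reindex_bij_witness[of _ "\<lambda>k. Suc n - k" "\<lambda>i. Suc n - i"]) auto
  also have "\<dots> = surj_poly (Suc n) (var_alpha - var_t) var_t"
    unfolding surj_poly_def by (intro sum.mono_neutral_left) (auto simp: Suc_le_eq)
  finally show ?thesis .
qed

lemma var_t_nonzero: "var_t \<noteq> 0"
  by (simp add: var_t_def)

lemma H_poly_permutohedron_0: "H_poly (permutohedron 0) = 1"
proof -
  have "var_t * H_poly (permutohedron 0) = var_t * 1"
    by (simp add: H_poly_permutohedron surj_poly_def)
  then show ?thesis using var_t_nonzero mult_left_cancel by blast
qed

lemma H_poly_permutohedron_recurrence:
  assumes n: "n \<ge> 1"
  shows "H_poly (permutohedron n) =
    (var_alpha + var_t) * H_poly (permutohedron (n - 1)) +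
    var_alpha * var_t * (\<Sum>i = 1..n - 1. of_nat (n choose i) *
      H_poly (permutohedron (i - 1)) * H_poly (permutohedron (n - i - 1)))"
proof -
  let ?H = "\<lambda>m. H_poly (permutohedron m)" and ?s = "\<lambda>m. surj_poly m (var_alpha - var_t) var_t"
  have s: "?s m = var_t * ?H (m - 1)" if "m \<ge> 1" for m
    using H_poly_permutohedron[of "m - 1"] that by simp
  have "var_t * ?H n = (var_alpha + var_t) * ?s n +
      var_alpha * (\<Sum>i = 1..n - 1. of_nat (n choose i) * (?s i * ?s (n - i)))"
    using surj_poly_recurrence[OF n, of "var_alpha - var_t" var_t] by (simp add: H_poly_permutohedron)
  also have "(\<Sum>i = 1..n - 1. of_nat (n choose i) * (?s i * ?s (n - i))) =
      (\<Sum>i = 1..n - 1. var_t * (var_t * (of_nat (n choose i) * ?H (i - 1) * ?H (n - i - 1))))"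
  proof (rule sum.cong[OF refl])
    fix i assume "i \<in> {1..n - 1}"
    then have "?s i = var_t * ?H (i - 1)" "?s (n - i) = var_t * ?H (n - i - 1)"
      by (intro s; simp; linarith)+
    then show "of_nat (n choose i) * (?s i * ?s (n - i)) =
        var_t * (var_t * (of_nat (n choose i) * ?H (i - 1) * ?H (n - i - 1)))"
      by (simp only: mult_ac)
  qed
  also have "(var_alpha + var_t) * ?s n + var_alpha * \<dots> = var_t * ((var_alpha + var_t) * ?H (n - 1) +
      var_alpha * var_t * (\<Sum>i = 1..n - 1. of_nat (n choose i) * ?H (i - 1) * ?H (n - i - 1)))"
    unfolding s[OF n] sum_distrib_left[symmetric] by (simp only: distrib_left mult_ac)
  finally show ?thesis using mult_left_cancel[OF var_t_nonzero] by blast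
qed

section \<open>The gamma expansion\<close>

definition gamma_expand :: "nat \<Rightarrow> int poly \<Rightarrow> int poly poly" where
  "gamma_expand d g = (\<Sum>i\<le>d div 2. of_int (coeff g i) *
     (var_alpha * var_t) ^ i * (var_alpha + var_t) ^ (d - 2 * i))"

lemma gamma_expand_add: "gamma_expand d (g + h) = gamma_expand d g + gamma_expand d h"
  by (simp add: gamma_expand_def distrib_right sum.distrib)

lemma gamma_expand_diff: "gamma_expand d (g - h) = gamma_expand d g - gamma_expand d h"
  by (simp add: gamma_expand_def left_diff_distrib sum_subtractf)

lemma gamma_expand_0 [simp]: "gamma_expand d 0 = 0"
  by (simp add: gamma_expand_def)

lemma gamma_expand_sum: "gamma_expand d (sum f A) = (\<Sum>a\<in>A. gamma_expand d (f a))"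
  by (induction A rule: infinite_finite_induct) (simp_all add: gamma_expand_add)

lemma gamma_expand_monom:
  assumes "k \<le> d div 2"
  shows "gamma_expand d (monom c k) =
    of_int c * (var_alpha * var_t) ^ k * (var_alpha + var_t) ^ (d - 2 * k)"
proof -
  have "gamma_expand d (monom c k) = (\<Sum>i\<le>d div 2. if i = k then
      of_int c * (var_alpha * var_t) ^ k * (var_alpha + var_t) ^ (d - 2 * k) else 0)"
    unfolding gamma_expand_def by (intro sum.cong) auto
  with assms show ?thesis by simp
qed

text \<open>
  With \<open>A = \<alpha> + t\<close> and \<open>B = \<alpha>t\<close> the expansion is \<open>A\<^sup>d g(B/A\<^sup>2)\<close>. Under the degree bounds the
  finite sums cut off no coefficient.
\<close>

lemma gamma_expand_mult:
  assumes "degree g \<le> d div 2" "degree h \<le> e div 2"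
  shows "gamma_expand d g * gamma_expand e h = gamma_expand (d + e) (g * h)"
proof -
  let ?A = "var_alpha + var_t" and ?B = "var_alpha * var_t"
  have "g * h = (\<Sum>i\<le>d div 2. monom (coeff g i) i) * (\<Sum>j\<le>e div 2. monom (coeff h j) j)"
    by (simp only: poly_as_sum_of_monoms'[OF assms(1)] poly_as_sum_of_monoms'[OF assms(2)])
  also have "\<dots> = (\<Sum>i\<le>d div 2. \<Sum>j\<le>e div 2. monom (coeff g i * coeff h j) (i + j))"
    by (simp add: sum_product mult_monom)
  finally have "g * h = \<dots>" .
  then have "gamma_expand (d + e) (g * h) =
      (\<Sum>i\<le>d div 2. \<Sum>j\<le>e div 2. gamma_expand (d + e) (monom (coeff g i * coeff h j) (i + j)))"
    by (simp add: gamma_expand_sum)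
  also have "\<dots> = (\<Sum>i\<le>d div 2. \<Sum>j\<le>e div 2.
      (of_int (coeff g i) * ?B ^ i * ?A ^ (d - 2 * i)) * (of_int (coeff h j) * ?B ^ j * ?A ^ (e - 2 * j)))"
  proof (intro sum.cong refl)
    fix i j assume "i \<in> {..d div 2}" "j \<in> {..e div 2}"
    then have ij: "i + j \<le> (d + e) div 2" and de: "d + e - 2 * (i + j) = (d - 2 * i) + (e - 2 * j)"
      by auto
    show "gamma_expand (d + e) (monom (coeff g i * coeff h j) (i + j)) =
        (of_int (coeff g i) * ?B ^ i * ?A ^ (d - 2 * i)) * (of_int (coeff h j) * ?B ^ j * ?A ^ (e - 2 * j))"
      unfolding gamma_expand_monom[OF ij] de power_add of_int_mult by (simp only: mult_ac)
  qed
  finally show ?thesis unfolding gamma_expand_def sum_product by simp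
qed

text \<open>
  The expansion is triangular: \<open>(\<alpha>t)\<^sup>j (\<alpha>+t)\<^sup>d\<^sup>-\<^sup>2\<^sup>j\<close> has lowest \<open>\<alpha>\<close>-exponent \<open>j\<close>, so the first nonzero
  coefficient of \<open>g\<close> survives.
\<close>

lemma gamma_expand_eq_0:
  assumes "gamma_expand d g = 0" "degree g \<le> d div 2"
  shows "g = 0"
proof (rule ccontr)
  assume "g \<noteq> 0"
  then have ex: "\<exists>i. coeff g i \<noteq> 0" by (auto simp: poly_eq_iff)
  define i where "i = (LEAST i. coeff g i \<noteq> 0)"
  have i: "coeff g i \<noteq> 0" unfolding i_def by (rule LeastI_ex[OF ex])
  have below: "coeff g j = 0" if "j < i" for j
    using that not_less_Least[of j "\<lambda>i. coeff g i \<noteq> 0"] unfolding i_def by simp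
  have "i \<le> d div 2" using le_degree[OF i] assms(2) by linarith
  let ?s = "\<lambda>j. of_int (coeff g j) * (var_alpha * var_t) ^ j * (var_alpha + var_t) ^ (d - 2 * j)"
  have "var_alpha * var_t = monom [:0, 1:] 1"
    by (simp add: var_alpha_def var_t_def monom_Suc flip: monom_0)
  then have mon: "(var_alpha * var_t) ^ j = monom ([:0, 1:] ^ j) j" for j
    by (simp only: monom_power mult_1)
  have coeff_s: "coeff (?s j) i = (if j = i then of_int (coeff g i) * [:0, 1:] ^ (d - i) else 0)"
    if "j \<le> d div 2" for j
  proof -
    have "?s j = monom ([:0, 1:] ^ j) j * (of_int (coeff g j) * (var_alpha + var_t) ^ (d - 2 * j))"
      unfolding mon by (simp only: mult_ac)
    then have *: "coeff (?s j) i = (if i < j then 0 else [:0, 1:] ^ j *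
        coeff (of_int (coeff g j) * (var_alpha + var_t) ^ (d - 2 * j)) (i - j))"
      by (auto simp only: coeff_monom_mult not_less split: if_splits)
    consider "j < i" | "j = i" | "j > i" by linarith
    then show ?thesis
    proof cases
      case 2
      have "coeff ((var_alpha + var_t) ^ e) 0 = [:0, 1:] ^ e" for e
        by (simp add: coeff_0_power var_alpha_def var_t_def)
      then have "coeff (?s j) i = of_int (coeff g i) * ([:0, 1:] ^ i * [:0, 1:] ^ (d - 2 * i))"
        unfolding * using 2 by (simp add: coeff_mult_0 of_int_poly)
      also have "[:0, 1:] ^ i * [:0, 1:] ^ (d - 2 * i) = ([:0, 1:] :: int poly) ^ (d - i)"
        using that 2 by (simp flip: power_add)
      finally show ?thesis using 2 by simp
    next
      case 1
      then show ?thesis by (simp add: below)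
    next
      case 3
      then show ?thesis unfolding * by simp
    qed
  qed
  have "0 = coeff (gamma_expand d g) i" using assms(1) by simp
  also have "\<dots> = (\<Sum>j\<le>d div 2. coeff (?s j) i)"
    by (simp add: gamma_expand_def coeff_sum)
  also have "\<dots> = (\<Sum>j\<le>d div 2. if j = i then of_int (coeff g i) * [:0, 1:] ^ (d - i) else 0)"
    by (intro sum.cong refl coeff_s) simp
  also have "\<dots> = of_int (coeff g i) * [:0, 1:] ^ (d - i)" using \<open>i \<le> d div 2\<close> by simp
  finally show False using i by simp
qed

lemma gamma_poly_eqI:
  assumes "degree g \<le> affine_dim P div 2" "H_poly P = gamma_expand (affine_dim P) g"
  shows "gamma_poly P = g"
  unfolding gamma_poly_def gamma_expand_def[symmetric]
proof (rule the_equality)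
  fix h assume h: "degree h \<le> affine_dim P div 2 \<and> H_poly P = gamma_expand (affine_dim P) h"
  have "gamma_expand (affine_dim P) (h - g) = 0" using h assms by (simp add: gamma_expand_diff)
  moreover have "degree (h - g) \<le> affine_dim P div 2" using h assms by (intro degree_diff_le) auto
  ultimately show "h = g" using gamma_expand_eq_0 by fastforce
qed (use assms in auto)

lemma gamma_expand_recurrence:
  assumes n: "n \<ge> 1"
    and deg: "\<And>m. m < n \<Longrightarrow> degree (g m) \<le> m div 2"
  shows "degree (g (n - 1) + var_tau * (\<Sum>i = 1..n - 1. of_nat (n choose i) * g (i - 1) * g (n - i - 1)))
      \<le> n div 2"
    and "gamma_expand n (g (n - 1) +
        var_tau * (\<Sum>i = 1..n - 1. of_nat (n choose i) * g (i - 1) * g (n - i - 1))) =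
      (var_alpha + var_t) * gamma_expand (n - 1) (g (n - 1)) +
      var_alpha * var_t * (\<Sum>i = 1..n - 1. of_nat (n choose i) *
        gamma_expand (i - 1) (g (i - 1)) * gamma_expand (n - i - 1) (g (n - i - 1)))"
proof -
  have tau: "var_tau = monom 1 1" "degree var_tau = 1"
    by (simp_all add: var_tau_def monom_altdef)
  have first: "degree (g (n - 1)) \<le> n div 2"
    using deg[of "n - 1"] n by (auto intro: order_trans div_le_mono)
  have deg_prod: "degree (of_nat (n choose i) * g (i - 1) * g (n - i - 1)) \<le> (n - 2) div 2"
    and deg_left: "degree (of_nat (n choose i) * g (i - 1)) \<le> (i - 1) div 2"
    and deg_right: "degree (g (n - i - 1)) \<le> (n - i - 1) div 2"
    if "i \<in> {1..n - 1}" for i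
  proof -
    have i: "i - 1 < n" "n - i - 1 < n" "i \<ge> 1" "i < n" using that by auto
    show 1: "degree (of_nat (n choose i) * g (i - 1)) \<le> (i - 1) div 2"
      using degree_mult_le[of "of_nat (n choose i)" "g (i - 1)"] deg[OF i(1)] by simp
    show 2: "degree (g (n - i - 1)) \<le> (n - i - 1) div 2" by (rule deg[OF i(2)])
    have "(i - 1) div 2 + (n - i - 1) div 2 \<le> (n - 2) div 2" using i(3,4) by auto
    then show "degree (of_nat (n choose i) * g (i - 1) * g (n - i - 1)) \<le> (n - 2) div 2"
      using degree_mult_le[of "of_nat (n choose i) * g (i - 1)" "g (n - i - 1)"] 1 2 by linarith
  qed
  let ?S = "\<Sum>i = 1..n - 1. of_nat (n choose i) * g (i - 1) * g (n - i - 1)"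
  have deg_S: "degree ?S \<le> (n - 2) div 2"
    by (intro degree_sum_le) (use deg_prod in auto)
  have deg_tau_S: "degree (var_tau * ?S) \<le> n div 2"
  proof (cases "n = 1")
    case False
    then have "1 + (n - 2) div 2 = n div 2" using n by auto
    then show ?thesis using degree_mult_le[of var_tau ?S] deg_S tau by linarith
  qed simp
  show "degree (g (n - 1) + var_tau * ?S) \<le> n div 2"
    using first deg_tau_S by (intro degree_add_le)
  have A: "gamma_expand 1 1 = var_alpha + var_t" and B: "gamma_expand 2 var_tau = var_alpha * var_t"
    by (simp_all add: gamma_expand_def var_tau_def)
  have "coeff (of_nat c :: int poly) 0 = of_nat c" for c by (simp add: of_nat_poly)
  then have C: "gamma_expand 0 (of_nat c) = of_nat c" for c by (simp add: gamma_expand_def)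
  have "gamma_expand n (g (n - 1)) = (var_alpha + var_t) * gamma_expand (n - 1) (g (n - 1))"
    using gamma_expand_mult[of 1 1 "g (n - 1)" "n - 1"] deg[of "n - 1"] n by (simp add: A[simplified])
  moreover have "gamma_expand n (var_tau * ?S) = var_alpha * var_t * (\<Sum>i = 1..n - 1. of_nat (n choose i) *
        gamma_expand (i - 1) (g (i - 1)) * gamma_expand (n - i - 1) (g (n - i - 1)))"
  proof (cases "n = 1")
    case False
    then have n2: "2 + (n - 2) = n" using n by auto
    have "degree var_tau \<le> 2 div 2" using tau by simp
    from gamma_expand_mult[OF this deg_S]
    have "gamma_expand n (var_tau * ?S) = var_alpha * var_t * gamma_expand (n - 2) ?S"
      by (simp only: B n2)
    also have "gamma_expand (n - 2) ?S = (\<Sum>i = 1..n - 1. of_nat (n choose i) *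
        gamma_expand (i - 1) (g (i - 1)) * gamma_expand (n - i - 1) (g (n - i - 1)))"
      unfolding gamma_expand_sum
    proof (rule sum.cong[OF refl])
      fix i assume i: "i \<in> {1..n - 1}"
      then have "n - 2 = (i - 1) + (n - i - 1)" by auto
      then have "gamma_expand (n - 2) (of_nat (n choose i) * g (i - 1) * g (n - i - 1)) =
          gamma_expand (i - 1) (of_nat (n choose i) * g (i - 1)) * gamma_expand (n - i - 1) (g (n - i - 1))"
        using gamma_expand_mult[OF deg_left[OF i] deg_right[OF i]] by simp
      moreover have "gamma_expand (i - 1) (of_nat (n choose i) * g (i - 1)) =
          of_nat (n choose i) * gamma_expand (i - 1) (g (i - 1))"
      proof -
        have "degree (g (i - 1)) \<le> (i - 1) div 2" using i by (intro deg) auto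
        from gamma_expand_mult[OF _ this, of "of_nat (n choose i)" 0] show ?thesis
          by (simp add: C)
      qed
      ultimately show "gamma_expand (n - 2) (of_nat (n choose i) * g (i - 1) * g (n - i - 1)) =
          of_nat (n choose i) * gamma_expand (i - 1) (g (i - 1)) * gamma_expand (n - i - 1) (g (n - i - 1))"
        by simp
    qed
    finally show ?thesis .
  qed simp
  ultimately show "gamma_expand n (g (n - 1) + var_tau * ?S) =
      (var_alpha + var_t) * gamma_expand (n - 1) (g (n - 1)) +
      var_alpha * var_t * (\<Sum>i = 1..n - 1. of_nat (n choose i) *
        gamma_expand (i - 1) (g (i - 1)) * gamma_expand (n - i - 1) (g (n - i - 1)))"
    by (simp add: gamma_expand_add)
qed

lemma gamma_poly_permutohedron_0: "gamma_poly (permutohedron 0) = 1"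
  by (rule gamma_poly_eqI)
    (simp_all add: affine_dim_permutohedron H_poly_permutohedron_0 gamma_expand_def)

text \<open>
  The right-hand side of the recurrence has the degree bound and the expansion that characterize
  the \<open>\<gamma>\<close>-polynomial of \<open>Pe\<^sup>n\<close>.
\<close>

lemma gamma_poly_permutohedron_step:
  assumes n: "n \<ge> 1"
    and below: "\<And>m. m < n \<Longrightarrow> degree (gamma_poly (permutohedron m)) \<le> m div 2"
      "\<And>m. m < n \<Longrightarrow> gamma_expand m (gamma_poly (permutohedron m)) = H_poly (permutohedron m)"
  shows "gamma_poly (permutohedron n) = gamma_poly (permutohedron (n - 1)) +
      var_tau * (\<Sum>i = 1..n - 1. of_nat (n choose i) *
        gamma_poly (permutohedron (i - 1)) * gamma_poly (permutohedron (n - i - 1)))"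
    and "degree (gamma_poly (permutohedron n)) \<le> n div 2"
    and "gamma_expand n (gamma_poly (permutohedron n)) = H_poly (permutohedron n)"
proof -
  let ?g = "\<lambda>m. gamma_poly (permutohedron m)"
  let ?R = "?g (n - 1) + var_tau * (\<Sum>i = 1..n - 1. of_nat (n choose i) * ?g (i - 1) * ?g (n - i - 1))"
  have deg: "degree ?R \<le> n div 2"
    by (rule gamma_expand_recurrence(1)[OF n below(1)])
  have "gamma_expand n ?R = (var_alpha + var_t) * gamma_expand (n - 1) (?g (n - 1)) +
      var_alpha * var_t * (\<Sum>i = 1..n - 1. of_nat (n choose i) *
        gamma_expand (i - 1) (?g (i - 1)) * gamma_expand (n - i - 1) (?g (n - i - 1)))"
    by (rule gamma_expand_recurrence(2)[OF n below(1)])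
  also have "gamma_expand (n - 1) (?g (n - 1)) = H_poly (permutohedron (n - 1))"
    using n by (intro below(2)) simp
  also have "(\<Sum>i = 1..n - 1. of_nat (n choose i) *
        gamma_expand (i - 1) (?g (i - 1)) * gamma_expand (n - i - 1) (?g (n - i - 1))) =
      (\<Sum>i = 1..n - 1. of_nat (n choose i) *
        H_poly (permutohedron (i - 1)) * H_poly (permutohedron (n - i - 1)))"
  proof (rule sum.cong[OF refl])
    fix i assume "i \<in> {1..n - 1}"
    then have "i - 1 < n" "n - i - 1 < n" by auto
    then show "of_nat (n choose i) * gamma_expand (i - 1) (?g (i - 1)) *
        gamma_expand (n - i - 1) (?g (n - i - 1)) =
        of_nat (n choose i) * H_poly (permutohedron (i - 1)) * H_poly (permutohedron (n - i - 1))"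
      by (simp only: below(2))
  qed
  finally have expand: "gamma_expand n ?R = H_poly (permutohedron n)"
    unfolding H_poly_permutohedron_recurrence[OF n] .
  show "?g n = ?R"
    using deg expand by (intro gamma_poly_eqI) (simp_all only: affine_dim_permutohedron)
  with deg expand show "degree (?g n) \<le> n div 2" "gamma_expand n (?g n) = H_poly (permutohedron n)"
    by metis+
qed

lemma gamma_poly_permutohedron:
  "degree (gamma_poly (permutohedron n)) \<le> n div 2 \<and>
   gamma_expand n (gamma_poly (permutohedron n)) = H_poly (permutohedron n)"
proof (induction n rule: less_induct)
  case (less n)
  show ?case
  proof (cases "n = 0")
    case True
    then show ?thesis
      by (simp add: gamma_poly_permutohedron_0 H_poly_permutohedron_0 gamma_expand_def)
  next
    case False
    then have "n \<ge> 1" by simp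
    then show ?thesis using gamma_poly_permutohedron_step[of n] less.IH by blast
  qed
qed

theorem mainTheorem8:
  fixes n :: nat
  assumes "n \<ge> 1"
  shows "gamma_poly (permutohedron n) =
           gamma_poly (permutohedron (n - 1)) +
           var_tau * (\<Sum>i = 1..n - 1. of_nat (n choose i) *
             gamma_poly (permutohedron (i - 1)) * gamma_poly (permutohedron (n - i - 1)))
       \<and> H_poly (permutohedron n) =
           (var_alpha + var_t) * H_poly (permutohedron (n - 1)) +
           var_alpha * var_t * (\<Sum>i = 1..n - 1. of_nat (n choose i) *
             H_poly (permutohedron (i - 1)) * H_poly (permutohedron (n - i - 1)))"
  using gamma_poly_permutohedron_step(1)[OF assms] gamma_poly_permutohedron
    H_poly_permutohedron_recurrence[OF assms] by blast

end
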